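(* Let $m,n\ge 2$ be integers, let $K$ be a field and let $G$ be a connected simple graph on the vertex set $[n]$. Then $J_m(G)$ is a complete intersection if and only if $m=2$ and $G$ is a path graph.
   Context: $[n]=\{1,\dots,n\}$. $R=K[x_{ij}: i\in[m], j\in[n]]$ is the polynomial ring in $mn$ variables over the field $K$. For a simple graph $G$ on $[n]$, the generalized binomial edge ideal $J_m(G)\subset R$ is the ideal generated by all $x_{ki}x_{lj}-x_{kj}x_{li}$ with $1\le k<l\le m$ and $\{i,j\}$ an edge of $G$, $i<j$. $J_m(G)$ is a complete intersection if $\mu(J_m(G))=\mathrm{ht}(J_m(G))$, where $\mu$ denotes the minimal number of generators and $\mathrm{ht}$ the height. *)

theory Defs
  imports
    "HOL-Algebra.Ideal"
    "HOL-Library.Poly_Mapping"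
    "HOL-Library.Extended_Nat"
begin

section \<open>Height, number of generators, complete intersections\<close>

definition prime_height :: "('a, 'b) ring_scheme \<Rightarrow> 'a set \<Rightarrow> enat" where
  "prime_height R P = Sup {enat h | h. \<exists>C :: nat \<Rightarrow> 'a set.
     (\<forall>i\<le>h. primeideal (C i) R) \<and> (\<forall>i<h. C i \<subset> C (Suc i)) \<and> C h = P}"

definition ideal_height :: "('a, 'b) ring_scheme \<Rightarrow> 'a set \<Rightarrow> enat" where
  "ideal_height R I = Inf {prime_height R P | P. primeideal P R \<and> I \<subseteq> P}"

text \<open>Infinite if \<open>I\<close> is not finitely generated.\<close>

definition min_num_generators :: "('a, 'b) ring_scheme \<Rightarrow> 'a set \<Rightarrow> enat" where
  "min_num_generators R I =
     Inf {enat (card S) | S. finite S \<and> S \<subseteq> carrier R \<and> Idl\<^bsub>R\<^esub> S = I}"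

definition complete_intersection :: "('a, 'b) ring_scheme \<Rightarrow> 'a set \<Rightarrow> bool" where
  "complete_intersection R I \<longleftrightarrow> min_num_generators R I = ideal_height R I"


section \<open>Polynomial rings\<close>

text \<open>A polynomial in variables of type \<open>'v\<close> maps a monomial (an exponent vector
  \<open>'v \<Rightarrow>\<^sub>0 nat\<close> of finite support) to its coefficient.\<close>

type_synonym ('v, 'k) mpolynomial = "('v \<Rightarrow>\<^sub>0 nat) \<Rightarrow>\<^sub>0 'k"

definition indeterminate :: "'v \<Rightarrow> ('v, 'k::zero_neq_one) mpolynomial" where
  "indeterminate v = Poly_Mapping.single (Poly_Mapping.single v 1) 1"

text \<open>The subring of the polynomials involving only variables from \<open>X\<close>.\<close>

definition polynomial_ring :: "'v set \<Rightarrow> ('v, 'k::comm_ring_1) mpolynomial ring" where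
  "polynomial_ring X =
     \<lparr>carrier = {p. \<forall>t \<in> Poly_Mapping.keys p. Poly_Mapping.keys t \<subseteq> X},
      mult = (*), one = 1, zero = 0, add = (+)\<rparr>"

lemma cring_polynomial_ring:
  "cring (polynomial_ring X :: ('v, 'k::comm_ring_1) mpolynomial ring)"
proof (rule cringI)
  let ?R = "polynomial_ring X :: ('v, 'k) mpolynomial ring"
  show "abelian_group ?R"
  proof (rule abelian_groupI)
    fix p q :: "('v, 'k) mpolynomial"
    assume "p \<in> carrier ?R" "q \<in> carrier ?R"
    then show "p \<oplus>\<^bsub>?R\<^esub> q \<in> carrier ?R"
      using Poly_Mapping.keys_add[of p q] by (auto simp: polynomial_ring_def)
  next
    fix p :: "('v, 'k) mpolynomial"
    assume "p \<in> carrier ?R"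
    then have "- p \<in> carrier ?R \<and> - p \<oplus>\<^bsub>?R\<^esub> p = \<zero>\<^bsub>?R\<^esub>"
      by (auto simp: polynomial_ring_def Poly_Mapping.in_keys_iff)
    then show "\<exists>q\<in>carrier ?R. q \<oplus>\<^bsub>?R\<^esub> p = \<zero>\<^bsub>?R\<^esub>" by blast
  qed (auto simp: polynomial_ring_def algebra_simps)
  show "comm_monoid ?R"
  proof (rule comm_monoidI)
    fix p q :: "('v, 'k) mpolynomial"
    assume pq: "p \<in> carrier ?R" "q \<in> carrier ?R"
    have "Poly_Mapping.keys t \<subseteq> X" if t_in: "t \<in> Poly_Mapping.keys (p * q)" for t
    proof -
      obtain a b where t: "t = a + b"
        and "a \<in> Poly_Mapping.keys p" "b \<in> Poly_Mapping.keys q"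
        using t_in Poly_Mapping.keys_mult[of p q] by blast
      with pq have "Poly_Mapping.keys a \<subseteq> X" "Poly_Mapping.keys b \<subseteq> X"
        by (auto simp: polynomial_ring_def)
      then show ?thesis
        unfolding t using Poly_Mapping.keys_add[of a b] by blast
    qed
    then show "p \<otimes>\<^bsub>?R\<^esub> q \<in> carrier ?R"
      by (simp add: polynomial_ring_def)
  qed (auto simp: polynomial_ring_def algebra_simps)
qed (auto simp: polynomial_ring_def algebra_simps)


section \<open>Simple graphs\<close>

text \<open>A simple graph is given by its vertex set and a set of two-element edges.\<close>

definition simple_graph :: "'v set \<Rightarrow> 'v set set \<Rightarrow> bool" where
  "simple_graph V E \<longleftrightarrow> (\<forall>e\<in>E. e \<subseteq> V \<and> card e = 2)"

definition connected_graph :: "'v set \<Rightarrow> 'v set set \<Rightarrow> bool" where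
  "connected_graph V E \<longleftrightarrow>
     V \<noteq> {} \<and> (\<forall>u\<in>V. \<forall>v\<in>V. (u, v) \<in> {(a, b). {a, b} \<in> E}\<^sup>*)"

text \<open>The vertices can be listed as \<open>v\<^sub>1, \<dots>, v\<^sub>n\<close> so that the edges are exactly
  the pairs of consecutive vertices.\<close>

definition path_graph :: "'v set \<Rightarrow> 'v set set \<Rightarrow> bool" where
  "path_graph V E \<longleftrightarrow>
     (\<exists>vs. vs \<noteq> [] \<and> distinct vs \<and> set vs = V \<and>
           E = {{vs ! i, vs ! Suc i} | i. Suc i < length vs})"


section \<open>Generalized binomial edge ideals\<close>

definition matrix_polynomial_ring ::
    "nat \<Rightarrow> nat \<Rightarrow> (nat \<times> nat, 'k::field) mpolynomial ring" where
  "matrix_polynomial_ring m n = polynomial_ring ({1..m} \<times> {1..n})"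

definition generalized_binomial_edge_ideal ::
    "nat \<Rightarrow> nat \<Rightarrow> nat set set \<Rightarrow> (nat \<times> nat, 'k::field) mpolynomial set" where
  "generalized_binomial_edge_ideal m n E =
     Idl\<^bsub>matrix_polynomial_ring m n\<^esub>
       {indeterminate (k, i) * indeterminate (l, j)
          - indeterminate (k, j) * indeterminate (l, i)
        | k l i j. 1 \<le> k \<and> k < l \<and> l \<le> m \<and> {i, j} \<in> E \<and> i < j}"

end

theory Submission
  imports Defs "HOL-Algebra.Ring_Divisibility" "HOL-Library.Product_Lexorder"
begin

text \<open>The \<open>2\<close>-minors generating \<open>J\<close> are quadrics, and their coefficients at the main-diagonal
  monomials show that no fewer elements generate \<open>J\<close>; so the minimal number of generators is
  \<open>(m choose 2) * |E|\<close>.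

  If \<open>r\<close> elements are algebraically independent modulo a prime \<open>P\<close> of a polynomial ring in \<open>N\<close>
  variables, then \<open>P\<close> has height at most \<open>N - r\<close>: a longer chain below \<open>P\<close> would give
  more than \<open>N\<close> elements, hence an algebraic relation, from which the elements separating
  consecutive primes are eliminated one after another. Making all columns of the matrix proportional
  gives a prime over \<open>J\<close> of height at most \<open>(m - 1) * (n - 1)\<close>, which forces \<open>m = 2\<close> and
  \<open>|E| = n - 1\<close>. If the tree is not a path, it has a vertex of degree at least three, and killing that
  column and making only the columns in each remaining component proportional gives a prime over \<open>J\<close>
  of height at most \<open>n - 2\<close>.

  Conversely, along a path the minors of consecutive columns form a regular sequence, and a prime over
  an ideal generated by a regular sequence of length \<open>r\<close> has height at least \<open>r\<close>: a nonzerodivisor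
  modulo \<open>I\<close> lying in a prime \<open>P\<close> over \<open>I\<close> is avoided by some smaller prime over \<open>I\<close>.\<close>


section \<open>Prime ideals and height\<close>

lemma (in cring) cring_idealI:
  assumes "I \<subseteq> carrier R" "\<zero> \<in> I"
    and "\<And>a b. a \<in> I \<Longrightarrow> b \<in> I \<Longrightarrow> a \<oplus> b \<in> I"
    and "\<And>a x. a \<in> I \<Longrightarrow> x \<in> carrier R \<Longrightarrow> x \<otimes> a \<in> I"
  shows "ideal I R"
proof (rule idealI[OF ring_axioms])
  show "subgroup I (add_monoid R)"
  proof (rule group.subgroupI[OF add.is_group])
    fix a assume a: "a \<in> I"
    then have "\<ominus> a = (\<ominus> \<one>) \<otimes> a"
      using assms(1) by (simp add: l_minus subset_iff)
    then show "inv\<^bsub>add_monoid R\<^esub> a \<in> I"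
      using assms(4)[OF a, of "\<ominus> \<one>"] by (simp add: a_inv_def)
  qed (use assms in auto)
qed (use assms in \<open>auto simp: m_comm subset_iff\<close>)

text \<open>By Zorn's lemma some ideal Q is maximal among those that contain I and miss S. If a and
  b lie outside Q, then Q + (a) and Q + (b) both meet S. Multiplying an element of each meeting
  gives an element of S that would lie in Q if the product of a and b did.\<close>

lemma (in cring) ex_primeideal_disjoint:
  assumes I: "ideal I R" and S: "S \<subseteq> carrier R" "\<one> \<in> S"
    and mult: "\<And>a b. a \<in> S \<Longrightarrow> b \<in> S \<Longrightarrow> a \<otimes> b \<in> S"
    and disj: "I \<inter> S = {}"
  obtains Q where "primeideal Q R" "I \<subseteq> Q" "Q \<inter> S = {}"
proof -
  define \<A> where "\<A> = {J. ideal J R \<and> I \<subseteq> J \<and> J \<inter> S = {}}"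
  have "\<exists>M\<in>\<A>. \<forall>X\<in>\<A>. M \<subseteq> X \<longrightarrow> X = M"
  proof (rule subset_Zorn_nonempty)
    show "\<A> \<noteq> {}"
      using I disj by (auto simp: \<A>_def)
    fix \<C> assume C: "\<C> \<noteq> {}" "subset.chain \<A> \<C>"
    then have CA: "\<And>J. J \<in> \<C> \<Longrightarrow> ideal J R \<and> I \<subseteq> J \<and> J \<inter> S = {}"
      and dir: "\<And>J K. J \<in> \<C> \<Longrightarrow> K \<in> \<C> \<Longrightarrow> J \<subseteq> K \<or> K \<subseteq> J"
      unfolding \<A>_def subset.chain_def by blast+
    have "ideal (\<Union>\<C>) R"
      using chain_Union_is_ideal[of \<C>] C CA by (auto simp: subset.chain_def)
    then show "\<Union>\<C> \<in> \<A>"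
      unfolding \<A>_def using CA C(1) by blast
  qed
  then obtain Q where "Q \<in> \<A>" and QA: "\<And>X. X \<in> \<A> \<Longrightarrow> Q \<subseteq> X \<Longrightarrow> X = Q"
    by metis
  then have Q: "ideal Q R" "I \<subseteq> Q" "Q \<inter> S = {}"
    by (simp_all add: \<A>_def)
  have max: "X = Q" if "ideal X R" "Q \<subseteq> X" "X \<inter> S = {}" for X
    using that Q(2) by (intro QA) (auto simp: \<A>_def)
  interpret Q: ideal Q R by (rule Q(1))
  have meets: "\<exists>q r. q \<in> Q \<and> r \<in> carrier R \<and> q \<oplus> r \<otimes> a \<in> S"
    if a: "a \<in> carrier R" "a \<notin> Q" for a
  proof (rule ccontr)
    assume neg: "\<not> ?thesis"
    let ?X = "Q <+>\<^bsub>R\<^esub> PIdl a"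
    have X: "\<And>x. x \<in> ?X \<longleftrightarrow> (\<exists>q\<in>Q. \<exists>r\<in>carrier R. x = q \<oplus> r \<otimes> a)"
      unfolding set_add_def' cgenideal_def by blast
    have "ideal ?X R"
      by (rule add_ideals[OF Q(1) cgenideal_ideal[OF a(1)]])
    moreover have "Q \<subseteq> ?X"
    proof
      fix x assume "x \<in> Q"
      then show "x \<in> ?X"
        unfolding X using a by (intro bexI[of _ x] bexI[of _ \<zero>]) auto
    qed
    moreover have "?X \<inter> S = {}"
    proof (rule ccontr)
      assume "?X \<inter> S \<noteq> {}"
      then obtain x where "x \<in> ?X" "x \<in> S"
        by blast
      then show False
        using neg unfolding X by auto
    qed
    ultimately have "?X = Q"
      by (rule max)
    moreover have "a \<in> ?X"
      unfolding X using a by (intro bexI[of _ \<zero>] bexI[of _ \<one>]) auto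
    ultimately show False
      using a by simp
  qed
  have "primeideal Q R"
  proof (rule primeidealI[OF Q(1) is_cring])
    show "carrier R \<noteq> Q"
      using Q(3) S by auto
    fix a b assume ab: "a \<in> carrier R" "b \<in> carrier R" "a \<otimes> b \<in> Q"
    show "a \<in> Q \<or> b \<in> Q"
    proof (rule ccontr)
      assume "\<not> ?thesis"
      then obtain q r q' r' where q: "q \<in> Q" "r \<in> carrier R" "q \<oplus> r \<otimes> a \<in> S"
        and q': "q' \<in> Q" "r' \<in> carrier R" "q' \<oplus> r' \<otimes> b \<in> S"
        using meets ab by meson
      note c = ab(1,2) q(2) q'(2) Q.Icarr[OF q(1)] Q.Icarr[OF q'(1)]
      have "(q \<oplus> r \<otimes> a) \<otimes> (q' \<oplus> r' \<otimes> b)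
          = (q \<otimes> (q' \<oplus> r' \<otimes> b) \<oplus> (r \<otimes> a) \<otimes> q') \<oplus> (r \<otimes> r') \<otimes> (a \<otimes> b)"
        using c by algebra
      also have "\<dots> \<in> Q"
        using c by (intro Q.a_closed Q.I_r_closed[OF q(1)] Q.I_l_closed[OF q'(1)]
            Q.I_l_closed[OF ab(3)]) auto
      finally show False
        using mult[OF q(3) q'(3)] Q(3) by blast
    qed
  qed
  then show thesis
    using Q that by blast
qed

text \<open>The multiplicative set consists of the products of an element outside P and a power of
  f. It misses I because f can be cancelled modulo I and I lies in P. A prime that misses it lies in
  P (exponent 0) and does not contain f (exponent 1).\<close>

lemma (in cring) ex_primeideal_psubset:
  assumes P: "primeideal P R" and I: "ideal I R" "I \<subseteq> P" and f: "f \<in> P"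
    and nzd: "\<And>g. g \<in> carrier R \<Longrightarrow> f \<otimes> g \<in> I \<Longrightarrow> g \<in> I"
  obtains Q where "primeideal Q R" "I \<subseteq> Q" "Q \<subset> P"
proof -
  interpret P: primeideal P R by (rule P)
  have fc: "f \<in> carrier R" using f by simp
  have one: "\<one> \<notin> P"
    using P.I_notcarr P.one_imp_carrier by blast
  define S where "S = {s \<otimes> f [^] n | s n. s \<in> carrier R - P \<and> (n :: nat) \<in> UNIV}"
  have pow: "f [^] n \<otimes> s \<in> I \<Longrightarrow> s \<in> I" if "s \<in> carrier R" for n :: nat and s
  proof (induction n)
    case (Suc n)
    have "f [^] Suc n \<otimes> s = f \<otimes> (f [^] n \<otimes> s)"
      using that fc by (simp add: m_assoc m_comm[of "f [^] n" f])
    then have "f \<otimes> (f [^] n \<otimes> s) \<in> I"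
      using Suc.prems by metis
    then have "f [^] n \<otimes> s \<in> I"
      by (rule nzd[rotated]) (use that fc in simp)
    then show ?case
      by (rule Suc.IH)
  qed (use that in simp)
  have S: "s \<otimes> f [^] n \<in> S" if "s \<in> carrier R" "s \<notin> P" for s and n :: nat
    using that unfolding S_def by auto
  have "\<one> \<otimes> f [^] (0::nat) \<in> S"
    by (rule S) (use one in auto)
  then have 1: "\<one> \<in> S" by simp
  obtain Q where Q: "primeideal Q R" "I \<subseteq> Q" "Q \<inter> S = {}"
  proof (rule ex_primeideal_disjoint[OF I(1) _ 1])
    show "S \<subseteq> carrier R"
      unfolding S_def using fc by auto
    show "I \<inter> S = {}"
      unfolding S_def using pow I(2) fc by (auto simp: m_comm)
    fix a b assume "a \<in> S" "b \<in> S"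
    then obtain s t and m n :: nat where st: "s \<in> carrier R - P" "t \<in> carrier R - P"
      "a = s \<otimes> f [^] m" "b = t \<otimes> f [^] n"
      unfolding S_def by blast
    then have "a \<otimes> b = (s \<otimes> t) \<otimes> f [^] (m + n)"
      using fc by (simp add: nat_pow_mult[symmetric] m_ac)
    moreover have "s \<otimes> t \<in> carrier R - P"
      using st P.I_prime by blast
    ultimately show "a \<otimes> b \<in> S"
      using S by simp
  qed
  have "Q \<subseteq> P"
  proof
    fix s assume s: "s \<in> Q"
    then have "s \<in> carrier R"
      using ideal.Icarr primeideal.axioms(1) Q(1) by metis
    then show "s \<in> P"
      using S[of s 0] s Q(3) by auto
  qed
  moreover have "f \<notin> Q"
    using S[of \<one> 1] one Q(3) fc by auto
  ultimately show thesis
    using that[OF Q(1,2)] f by blast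
qed

text \<open>The chain is built downwards: the last nonzerodivisor yields a prime strictly inside P
  that still contains the previous ideal, and the induction hypothesis applies to that
  prime.\<close>

lemma (in cring) prime_height_ge:
  assumes "\<And>k. k \<le> r \<Longrightarrow> ideal (I k) R"
    and "\<And>k. k < r \<Longrightarrow> \<exists>f \<in> I (Suc k). \<forall>g \<in> carrier R. f \<otimes> g \<in> I k \<longrightarrow> g \<in> I k"
    and "\<And>k. k < r \<Longrightarrow> I k \<subseteq> I (Suc k)"
    and "primeideal P R" "I r \<subseteq> P"
  shows "enat r \<le> prime_height R P"
proof -
  have "\<exists>C :: nat \<Rightarrow> 'a set. (\<forall>i\<le>r. primeideal (C i) R) \<and> (\<forall>i<r. C i \<subset> C (Suc i)) \<and> C r = P"
    using assms
  proof (induction r arbitrary: P)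
    case 0
    then show ?case by auto
  next
    case (Suc r)
    obtain f where f: "f \<in> I (Suc r)" "\<And>g. g \<in> carrier R \<Longrightarrow> f \<otimes> g \<in> I r \<Longrightarrow> g \<in> I r"
      using Suc.prems(2)[of r] by auto
    obtain Q where Q: "primeideal Q R" "I r \<subseteq> Q" "Q \<subset> P"
    proof (rule ex_primeideal_psubset)
      show "primeideal P R" "ideal (I r) R" "I r \<subseteq> P" "f \<in> P"
        using Suc.prems(1)[of r] Suc.prems(3)[of r] Suc.prems(4,5) f(1) by auto
    qed (use f(2) in auto)
    obtain C where C: "\<And>i. i \<le> r \<Longrightarrow> primeideal (C i) R" "\<And>i. i < r \<Longrightarrow> C i \<subset> C (Suc i)" "C r = Q"
      using Suc.IH[of Q] Suc.prems Q by auto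
    have "\<forall>i\<le>Suc r. primeideal ((C(Suc r := P)) i) R"
      using C Suc.prems(4) by (auto simp: le_Suc_eq)
    moreover have "\<forall>i<Suc r. (C(Suc r := P)) i \<subset> (C(Suc r := P)) (Suc i)"
      using C Q by (auto simp: less_Suc_eq)
    ultimately show ?case
      by (intro exI[of _ "C(Suc r := P)"]) auto
  qed
  then have "enat r \<in> {enat h | h. \<exists>C :: nat \<Rightarrow> 'a set.
      (\<forall>i\<le>h. primeideal (C i) R) \<and> (\<forall>i<h. C i \<subset> C (Suc i)) \<and> C h = P}"
    by auto
  then show ?thesis
    unfolding prime_height_def by (rule Sup_upper)
qed


section \<open>Polynomial rings\<close>

text \<open>The quotient on division by v: terms divisible by v lose one factor v, and terms free of
  v are dropped, because the shift of exponents does not reach them.\<close>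

definition var_quotient :: "'v \<Rightarrow> ('v, 'k::zero) mpolynomial \<Rightarrow> ('v, 'k) mpolynomial" where
  "var_quotient v = Poly_Mapping.map_key (\<lambda>t. t + Poly_Mapping.single v 1)"

lemma lookup_var_quotient:
  "Poly_Mapping.lookup (var_quotient v p) t = Poly_Mapping.lookup p (t + Poly_Mapping.single v 1)"
  unfolding var_quotient_def by (subst map_key.rep_eq) (auto simp: inj_def)

lemma lookup_indeterminate_mult:
  fixes p :: "('v, 'k::comm_ring_1) mpolynomial"
  shows "Poly_Mapping.lookup (indeterminate v * p) t =
    (if Poly_Mapping.lookup t v = 0 then 0
     else Poly_Mapping.lookup p (t - Poly_Mapping.single v 1))"
proof -
  let ?X = "Poly_Mapping.single v 1 :: 'v \<Rightarrow>\<^sub>0 nat"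
  have "Poly_Mapping.lookup (indeterminate v * p) t
      = (\<Sum>l. (1 when l = ?X) * (\<Sum>q. Poly_Mapping.lookup p q when t = l + q))"
    unfolding indeterminate_def lookup_mult lookup_single
    by (intro Sum_any.cong) (auto simp: when_def)
  also have "\<dots> = (\<Sum>l. (\<Sum>q. Poly_Mapping.lookup p q when t = l + q) when l = ?X)"
    by (intro Sum_any.cong) (simp add: when_def)
  also have "\<dots> = (\<Sum>q. Poly_Mapping.lookup p q when t = ?X + q)"
    by simp
  also have "\<dots> = (if Poly_Mapping.lookup t v = 0 then 0 else Poly_Mapping.lookup p (t - ?X))"
  proof (cases "Poly_Mapping.lookup t v = 0")
    case True
    then have "t \<noteq> ?X + q" for q
      by (auto simp: lookup_add)
    then show ?thesis
      using True by simp
  next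
    case False
    then have "t = ?X + (t - ?X)"
      by (intro poly_mapping_eqI) (auto simp: lookup_add lookup_minus lookup_single when_def)
    then have "t = ?X + q \<longleftrightarrow> q = t - ?X" for q
      by (metis add_diff_cancel_left')
    then show ?thesis
      using False by simp
  qed
  finally show ?thesis .
qed

lemma var_quotient_0 [simp]: "var_quotient v 0 = 0"
  by (rule poly_mapping_eqI) (simp add: lookup_var_quotient)

lemma var_quotient_add: "var_quotient v (p + q) = var_quotient v p + var_quotient v q"
  by (rule poly_mapping_eqI) (simp add: lookup_var_quotient lookup_add)

lemma var_quotient_indeterminate_mult [simp]:
  fixes p :: "('v, 'k::comm_ring_1) mpolynomial"
  shows "var_quotient v (indeterminate v * p) = p"
  by (rule poly_mapping_eqI)
    (simp add: lookup_var_quotient lookup_indeterminate_mult lookup_add)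

text \<open>The remainder on division by v, that is, the part of p free of v
  (\<open>lookup_var_zero\<close>).\<close>

definition var_zero :: "'v \<Rightarrow> ('v, 'k::comm_ring_1) mpolynomial \<Rightarrow> ('v, 'k) mpolynomial" where
  "var_zero v p = p - indeterminate v * var_quotient v p"

lemma var_zero_decomp:
  fixes p :: "('v, 'k::comm_ring_1) mpolynomial"
  shows "p = var_zero v p + indeterminate v * var_quotient v p"
  by (simp add: var_zero_def)

lemma lookup_var_zero:
  fixes p :: "('v, 'k::comm_ring_1) mpolynomial"
  shows "Poly_Mapping.lookup (var_zero v p) t =
    (if Poly_Mapping.lookup t v = 0 then Poly_Mapping.lookup p t else 0)"
proof (cases "Poly_Mapping.lookup t v = 0")
  case False
  then have "t - Poly_Mapping.single v 1 + Poly_Mapping.single v 1 = t"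
    by (intro poly_mapping_eqI) (auto simp: lookup_add lookup_minus lookup_single when_def)
  then show ?thesis
    using False
    by (simp add: var_zero_def lookup_minus lookup_indeterminate_mult lookup_var_quotient)
qed (simp add: var_zero_def lookup_minus lookup_indeterminate_mult)

section \<open>Closure and division in polynomial rings over a given set of variables\<close>

lemma ring_polynomial_ring [simp]:
  "monoid.mult (polynomial_ring X) = (*)" "add (polynomial_ring X) = (+)"
  "zero (polynomial_ring X) = 0" "one (polynomial_ring X) = 1"
  by (simp_all add: polynomial_ring_def)

lemma carrier_polynomial_ring_iff:
  "p \<in> carrier (polynomial_ring X) \<longleftrightarrow>
    (\<forall>t. Poly_Mapping.lookup p t \<noteq> 0 \<longrightarrow> Poly_Mapping.keys t \<subseteq> X)"
  by (auto simp: polynomial_ring_def Poly_Mapping.in_keys_iff)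

context
  fixes X :: "'v set"
begin

interpretation cring "polynomial_ring X :: ('v, 'k::comm_ring_1) mpolynomial ring"
  by (rule cring_polynomial_ring)

lemma polynomial_ring_add_closed:
  "p \<in> carrier (polynomial_ring X) \<Longrightarrow> q \<in> carrier (polynomial_ring X)
    \<Longrightarrow> (p :: ('v, 'k::comm_ring_1) mpolynomial) + q \<in> carrier (polynomial_ring X)"
  using a_closed by simp

lemma polynomial_ring_mult_closed:
  "p \<in> carrier (polynomial_ring X) \<Longrightarrow> q \<in> carrier (polynomial_ring X)
    \<Longrightarrow> (p :: ('v, 'k::comm_ring_1) mpolynomial) * q \<in> carrier (polynomial_ring X)"
  using m_closed by simp

lemma polynomial_ring_zero_closed:
  "(0 :: ('v, 'k::comm_ring_1) mpolynomial) \<in> carrier (polynomial_ring X)"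
  using zero_closed by simp

lemma polynomial_ring_one_closed:
  "(1 :: ('v, 'k::comm_ring_1) mpolynomial) \<in> carrier (polynomial_ring X)"
  using one_closed by simp

end

lemma polynomial_ring_uminus_closed:
  "p \<in> carrier (polynomial_ring X) \<Longrightarrow>
    - (p :: ('v, 'k::comm_ring_1) mpolynomial) \<in> carrier (polynomial_ring X)"
  by (simp add: carrier_polynomial_ring_iff)

lemma polynomial_ring_diff_closed:
  "p \<in> carrier (polynomial_ring X) \<Longrightarrow> q \<in> carrier (polynomial_ring X)
    \<Longrightarrow> (p :: ('v, 'k::comm_ring_1) mpolynomial) - q \<in> carrier (polynomial_ring X)"
  using polynomial_ring_add_closed[of p X "- q"] polynomial_ring_uminus_closed[of q X] by simp

lemma polynomial_ring_power_closed:
  "p \<in> carrier (polynomial_ring X) \<Longrightarrow>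
    (p :: ('v, 'k::comm_ring_1) mpolynomial) ^ n \<in> carrier (polynomial_ring X)"
  by (induction n) (auto intro: polynomial_ring_one_closed polynomial_ring_mult_closed)

lemma polynomial_ring_sum_closed:
  "(\<And>a. a \<in> A \<Longrightarrow> f a \<in> carrier (polynomial_ring X)) \<Longrightarrow>
    (\<Sum>a\<in>A. f a :: ('v, 'k::comm_ring_1) mpolynomial) \<in> carrier (polynomial_ring X)"
  by (induction A rule: infinite_finite_induct)
    (auto intro: polynomial_ring_zero_closed polynomial_ring_add_closed)

lemma polynomial_ring_prod_closed:
  "(\<And>a. a \<in> A \<Longrightarrow> f a \<in> carrier (polynomial_ring X)) \<Longrightarrow>
    (\<Prod>a\<in>A. f a :: ('v, 'k::comm_ring_1) mpolynomial) \<in> carrier (polynomial_ring X)"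
  by (induction A rule: infinite_finite_induct)
    (auto intro: polynomial_ring_one_closed polynomial_ring_mult_closed)

lemma polynomial_ring_const_closed:
  "Poly_Mapping.single 0 c \<in> carrier (polynomial_ring X)"
  by (simp add: carrier_polynomial_ring_iff lookup_single when_def)

lemma polynomial_ring_indeterminate_closed:
  "v \<in> X \<Longrightarrow> indeterminate v \<in> carrier (polynomial_ring X)"
  by (auto simp: carrier_polynomial_ring_iff indeterminate_def lookup_single when_def)

lemmas polynomial_ring_closed =
  polynomial_ring_add_closed polynomial_ring_mult_closed polynomial_ring_zero_closed
  polynomial_ring_one_closed polynomial_ring_uminus_closed polynomial_ring_diff_closed
  polynomial_ring_power_closed polynomial_ring_sum_closed polynomial_ring_prod_closed
  polynomial_ring_const_closed polynomial_ring_indeterminate_closed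

lemma polynomial_ring_mono:
  "X \<subseteq> Y \<Longrightarrow> carrier (polynomial_ring X) \<subseteq> carrier (polynomial_ring Y)"
  by (auto simp: polynomial_ring_def)

lemma polynomial_ring_var_quotient_closed:
  assumes "p \<in> carrier (polynomial_ring X)"
  shows "var_quotient v p \<in> carrier (polynomial_ring X)"
proof -
  have "Poly_Mapping.keys t \<subseteq> Poly_Mapping.keys (t + Poly_Mapping.single v (1::nat))" for t
    by (auto simp: Poly_Mapping.in_keys_iff lookup_add)
  then show ?thesis
    using assms unfolding carrier_polynomial_ring_iff lookup_var_quotient by blast
qed

lemma polynomial_ring_var_zero_closed:
  "p \<in> carrier (polynomial_ring X) \<Longrightarrow> var_zero v p \<in> carrier (polynomial_ring (X - {v}))"
  by (auto simp: carrier_polynomial_ring_iff lookup_var_zero Poly_Mapping.in_keys_iff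
      split: if_splits)

lemma var_quotient_eq_0:
  assumes "p \<in> carrier (polynomial_ring X)" "v \<notin> X"
  shows "var_quotient v p = 0"
proof (rule poly_mapping_eqI)
  fix t
  have "v \<in> Poly_Mapping.keys (t + Poly_Mapping.single v (1::nat))"
    by (simp add: Poly_Mapping.in_keys_iff lookup_add)
  then show "Poly_Mapping.lookup (var_quotient v p) t = Poly_Mapping.lookup 0 t"
    using assms by (auto simp: lookup_var_quotient carrier_polynomial_ring_iff)
qed

text \<open>Splitting q into remainder and quotient, p times the remainder is free of v and so
  contributes nothing to the quotient.\<close>

lemma var_quotient_mult:
  fixes p q :: "('v, 'k::comm_ring_1) mpolynomial"
  assumes "p \<in> carrier (polynomial_ring X)" "v \<notin> X"
  shows "var_quotient v (p * q) = p * var_quotient v q"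
proof -
  let ?Y = "UNIV - {v}"
  have "p \<in> carrier (polynomial_ring ?Y)"
    using assms polynomial_ring_mono[of X ?Y] by auto
  moreover have "var_zero v q \<in> carrier (polynomial_ring ?Y)"
    by (rule polynomial_ring_var_zero_closed) (simp add: polynomial_ring_def)
  ultimately have "var_quotient v (p * var_zero v q) = 0"
    by (intro var_quotient_eq_0[of _ ?Y] polynomial_ring_mult_closed) auto
  moreover have "p * q = p * var_zero v q + indeterminate v * (p * var_quotient v q)"
    by (subst var_zero_decomp[of q v]) (simp add: algebra_simps)
  ultimately show ?thesis
    by (simp add: var_quotient_add)
qed

text \<open>Inductions on the number of divisions by v replace inductions on the degree in v. The
  sum of all exponents of v in p, plus one, is a crude but sufficient number.\<close>

lemma var_quotient_nilpotent: "\<exists>n. (var_quotient v ^^ n) p = 0"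
proof -
  have lookup: "Poly_Mapping.lookup ((var_quotient v ^^ n) p) t
      = Poly_Mapping.lookup p (t + Poly_Mapping.single v n)" for n t
  proof (induction n arbitrary: t)
    case (Suc n)
    have "Poly_Mapping.single v (Suc n) = Poly_Mapping.single v 1 + Poly_Mapping.single v n"
      by (metis Poly_Mapping.single_add plus_1_eq_Suc)
    then show ?case
      by (simp only: funpow.simps o_apply lookup_var_quotient Suc.IH add.assoc)
  qed simp
  define n where "n = Suc (\<Sum>t\<in>Poly_Mapping.keys p. Poly_Mapping.lookup t v)"
  have "t + Poly_Mapping.single v n \<notin> Poly_Mapping.keys p" for t
  proof
    assume "t + Poly_Mapping.single v n \<in> Poly_Mapping.keys p"
    from member_le_sum[OF this, of "\<lambda>t. Poly_Mapping.lookup t v"]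
    show False
      by (simp add: n_def lookup_add)
  qed
  then have "(var_quotient v ^^ n) p = 0"
    by (intro poly_mapping_eqI) (simp add: lookup Poly_Mapping.in_keys_iff)
  then show ?thesis ..
qed


section \<open>Algebraic dependence bounds the height from above\<close>

definition power_product :: "('v \<Rightarrow> 'a::comm_monoid_mult) \<Rightarrow> ('v \<Rightarrow>\<^sub>0 nat) \<Rightarrow> 'a" where
  "power_product f t = (\<Prod>v\<in>Poly_Mapping.keys t. f v ^ Poly_Mapping.lookup t v)"

lemma power_product_superset:
  assumes "finite V" "Poly_Mapping.keys t \<subseteq> V"
  shows "power_product f t = (\<Prod>v\<in>V. f v ^ Poly_Mapping.lookup t v)"
  unfolding power_product_def
  by (rule prod.mono_neutral_left) (use assms in \<open>auto simp: Poly_Mapping.in_keys_iff\<close>)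

lemma power_product_add: "power_product f (s + t) = power_product f s * power_product f t"
proof -
  let ?V = "Poly_Mapping.keys s \<union> Poly_Mapping.keys t"
  have "power_product f u = (\<Prod>v\<in>?V. f v ^ Poly_Mapping.lookup u v)"
    if "u \<in> {s, t, s + t}" for u
    by (rule power_product_superset) (use that keys_add[of s t] in auto)
  then show ?thesis
    by (simp add: lookup_add power_add prod.distrib)
qed

definition insertion ::
    "('v \<Rightarrow> ('w, 'k) mpolynomial) \<Rightarrow> ('v, 'k::comm_ring_1) mpolynomial \<Rightarrow> ('w, 'k) mpolynomial" where
  "insertion f p =
     (\<Sum>t\<in>Poly_Mapping.keys p. Poly_Mapping.single 0 (Poly_Mapping.lookup p t) * power_product f t)"

lemma insertion_superset:
  assumes "finite T" "Poly_Mapping.keys p \<subseteq> T"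
  shows "insertion f p =
    (\<Sum>t\<in>T. Poly_Mapping.single 0 (Poly_Mapping.lookup p t) * power_product f t)"
  unfolding insertion_def
  by (rule sum.mono_neutral_left) (use assms in \<open>auto simp: Poly_Mapping.in_keys_iff\<close>)

lemma insertion_0 [simp]: "insertion f 0 = 0"
  by (simp add: insertion_def)

lemma insertion_add: "insertion f (p + q) = insertion f p + insertion f q"
proof -
  let ?T = "Poly_Mapping.keys p \<union> Poly_Mapping.keys q"
  have "insertion f r =
      (\<Sum>t\<in>?T. Poly_Mapping.single 0 (Poly_Mapping.lookup r t) * power_product f t)"
    if "r \<in> {p, q, p + q}" for r
    by (rule insertion_superset) (use that keys_add[of p q] in auto)
  then show ?thesis
    by (simp add: lookup_add single_add distrib_right sum.distrib)
qed

lemma insertion_diff: "insertion f (p - q) = insertion f p - insertion f q"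
  using insertion_add[of f "p - q" q] by simp

lemma insertion_sum: "insertion f (\<Sum>a\<in>A. g a) = (\<Sum>a\<in>A. insertion f (g a))"
  by (induction A rule: infinite_finite_induct) (simp_all add: insertion_add)

lemma insertion_single: "insertion f (Poly_Mapping.single t c)
    = Poly_Mapping.single 0 c * power_product f t"
  by (subst insertion_superset[of "{t}"]) auto

lemma poly_mapping_eq_sum_single:
  "p = (\<Sum>t\<in>Poly_Mapping.keys p. Poly_Mapping.single t (Poly_Mapping.lookup p t))"
  by (rule poly_mapping_eqI)
    (auto simp: lookup_sum lookup_single when_def Poly_Mapping.in_keys_iff if_distrib cong: if_cong)

text \<open>Additivity in both factors reduces the claim to products of two single terms.\<close>

lemma insertion_mult:
  fixes p q :: "('v, 'k::comm_ring_1) mpolynomial" and f :: "'v \<Rightarrow> ('w, 'k) mpolynomial"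
  shows "insertion f (p * q) = insertion f p * insertion f q"
proof -
  have single: "insertion f (Poly_Mapping.single s a * Poly_Mapping.single t b)
      = insertion f (Poly_Mapping.single s a) * insertion f (Poly_Mapping.single t b)"
    for s t :: "'v \<Rightarrow>\<^sub>0 nat" and a b :: 'k
  proof -
    have const: "Poly_Mapping.single 0 (a * b)
        = (Poly_Mapping.single 0 a * Poly_Mapping.single 0 b :: ('w, 'k) mpolynomial)"
      by (simp add: mult_single)
    then show ?thesis
      unfolding mult_single[of s a t b] insertion_single power_product_add
      by (simp only: const mult_ac)
  qed
  show ?thesis
    apply (subst (1 2) poly_mapping_eq_sum_single[of p])
    apply (subst (1 2) poly_mapping_eq_sum_single[of q])
    apply (simp only: sum_product insertion_sum single)
    done
qed

lemma insertion_indeterminate [simp]: "insertion f (indeterminate v) = f v"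
  by (simp add: indeterminate_def insertion_single power_product_def)

lemma insertion_cong:
  assumes "p \<in> carrier (polynomial_ring V)" "\<And>v. v \<in> V \<Longrightarrow> f v = g v"
  shows "insertion f p = insertion g p"
proof -
  have "power_product f t = power_product g t" if "t \<in> Poly_Mapping.keys p" for t
    using assms that unfolding power_product_def polynomial_ring_def
    by (intro prod.cong arg_cong2[of _ _ _ _ "(^)"]) auto
  then show ?thesis
    by (simp add: insertion_def)
qed

lemma power_product_closed:
  assumes "\<And>v. v \<in> V \<Longrightarrow> f v \<in> carrier (polynomial_ring X)" "Poly_Mapping.keys t \<subseteq> V"
  shows "power_product f t \<in> carrier (polynomial_ring X)"
  using assms unfolding power_product_def by (intro polynomial_ring_closed) auto

lemma insertion_closed:
  assumes "\<And>v. v \<in> V \<Longrightarrow> f v \<in> carrier (polynomial_ring X)" "p \<in> carrier (polynomial_ring V)"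
  shows "insertion f p \<in> carrier (polynomial_ring X)"
  unfolding insertion_def
  by (intro polynomial_ring_sum_closed polynomial_ring_mult_closed polynomial_ring_const_closed
      power_product_closed[of V]) (use assms in \<open>auto simp: polynomial_ring_def\<close>)

section \<open>Linear systems and the counting of monomials\<close>

lemma lookup_const_mult:
  fixes p :: "('v, 'k::comm_ring_1) mpolynomial"
  shows "Poly_Mapping.lookup (Poly_Mapping.single 0 c * p) t = c * Poly_Mapping.lookup p t"
proof -
  have "Poly_Mapping.lookup (Poly_Mapping.map ((*) c) p) t = c * Poly_Mapping.lookup p t"
    by (simp add: Poly_Mapping.map.rep_eq when_def)
  then show ?thesis
    by (simp add: mult_map_scale_conv_mult)
qed

text \<open>Gaussian elimination with one equation removed at a time. If equation \<open>s0\<close>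
  is not trivial, an unknown \<open>g0\<close> with nonzero coefficient is eliminated from the
  others; this costs one unknown and one equation.\<close>

lemma homogeneous_system_nontrivial_solution:
  fixes c :: "'a \<Rightarrow> 'b \<Rightarrow> 'k::field"
  assumes "finite S" "finite G" "card S < card G"
  obtains u where "\<exists>g\<in>G. u g \<noteq> 0" "\<And>s. s \<in> S \<Longrightarrow> (\<Sum>g\<in>G. u g * c g s) = 0"
proof -
  have "\<exists>u. (\<exists>g\<in>G. u g \<noteq> 0) \<and> (\<forall>s\<in>S. (\<Sum>g\<in>G. u g * c g s) = 0)"
    using assms
  proof (induction S arbitrary: G c rule: finite_induct)
    case empty
    then have "G \<noteq> {}"
      by auto
    then show ?case
      by (intro exI[of _ "\<lambda>_. 1"]) auto
  next
    case (insert s0 S)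
    show ?case
    proof (cases "\<forall>g\<in>G. c g s0 = 0")
      case True
      have "card S < card G"
        using insert by simp
      then show ?thesis
        using insert.IH[of G c] insert.prems True by auto
    next
      case False
      then obtain g0 where g0: "g0 \<in> G" "c g0 s0 \<noteq> 0"
        by auto
      let ?G = "G - {g0}"
      define c' where "c' g s = c g s - c g s0 / c g0 s0 * c g0 s" for g s
      have "card S < card ?G"
        using insert g0 by simp
      then obtain u where u: "\<exists>g\<in>?G. u g \<noteq> 0" "\<forall>s\<in>S. (\<Sum>g\<in>?G. u g * c' g s) = 0"
        using insert.IH[of ?G c'] insert.prems by auto
      \<comment> \<open>The value that equation \<open>s0\<close> forces at the pivot. With it, the
        reduced equations with coefficients \<open>c'\<close> turn back into the original
        ones.\<close>
      define a where "a = - (\<Sum>g\<in>?G. u g * c g s0) / c g0 s0"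
      define w where "w = u(g0 := a)"
      have split: "(\<Sum>g\<in>G. w g * c g s) = a * c g0 s + (\<Sum>g\<in>?G. u g * c g s)" for s
      proof -
        have "(\<Sum>g\<in>G. w g * c g s) = w g0 * c g0 s + (\<Sum>g\<in>?G. w g * c g s)"
          using insert.prems g0 by (intro sum.remove) auto
        also have "(\<Sum>g\<in>?G. w g * c g s) = (\<Sum>g\<in>?G. u g * c g s)"
          by (intro sum.cong) (auto simp: w_def)
        finally show ?thesis by (simp add: w_def)
      qed
      have "(\<Sum>g\<in>G. w g * c g s) = 0" if "s \<in> S" for s
      proof -
        have "(\<Sum>g\<in>?G. u g * c' g s)
            = (\<Sum>g\<in>?G. u g * c g s) - (\<Sum>g\<in>?G. u g * c g s0) / c g0 s0 * c g0 s"
          by (simp add: c'_def algebra_simps sum_subtractf sum_distrib_left sum_distrib_right sum_divide_distrib)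
        then show ?thesis
          using u(2) that unfolding split a_def by simp
      qed
      moreover have "(\<Sum>g\<in>G. w g * c g s0) = 0"
        unfolding split a_def using g0 by simp
      moreover have "\<exists>g\<in>G. w g \<noteq> 0"
        using u(1) by (auto simp: w_def)
      ultimately show ?thesis
        by (intro exI[of _ w]) auto
    qed
  qed
  then show thesis
    using that by blast
qed

text \<open>Bounding each exponent separately, rather than the total degree, makes the number of
  monomials an exact power.\<close>

definition exponent_box :: "'v set \<Rightarrow> nat \<Rightarrow> ('v \<Rightarrow>\<^sub>0 nat) set" where
  "exponent_box V d = {t. Poly_Mapping.keys t \<subseteq> V \<and> (\<forall>v\<in>V. Poly_Mapping.lookup t v < d)}"

lemma exponent_box_card:
  assumes "finite V"
  shows "finite (exponent_box V d)" "card (exponent_box V d) = d ^ card V"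
proof -
  let ?F = "V \<rightarrow>\<^sub>E {..<d}"
  let ?abs = "\<lambda>f. Abs_poly_mapping (\<lambda>v. if v \<in> V then f v else 0)"
  have abs: "Poly_Mapping.lookup (?abs f) = (\<lambda>v. if v \<in> V then f v else 0)" for f :: "'a \<Rightarrow> nat"
    by (rule lookup_Abs_poly_mapping) (use assms in simp)
  have "bij_betw (\<lambda>t. restrict (Poly_Mapping.lookup t) V) (exponent_box V d) ?F"
  proof (rule bij_betw_byWitness[where f' = ?abs])
    show "\<forall>t\<in>exponent_box V d. ?abs (restrict (Poly_Mapping.lookup t) V) = t"
      by (intro ballI poly_mapping_eqI)
        (auto simp: abs exponent_box_def Poly_Mapping.in_keys_iff)
    show "\<forall>f\<in>?F. restrict (Poly_Mapping.lookup (?abs f)) V = f"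
      by (auto simp: abs fun_eq_iff PiE_def extensional_def)
    show "?abs ` ?F \<subseteq> exponent_box V d"
      by (auto simp: exponent_box_def abs Poly_Mapping.in_keys_iff split: if_splits)
  qed (auto simp: exponent_box_def)
  moreover have "finite ?F" "card ?F = d ^ card V"
    using assms by (auto simp: finite_PiE card_PiE)
  ultimately show "finite (exponent_box V d)" "card (exponent_box V d) = d ^ card V"
    using bij_betw_finite bij_betw_same_card by fastforce+
qed

definition exponents_le :: "nat \<Rightarrow> ('v, 'k::zero) mpolynomial \<Rightarrow> bool" where
  "exponents_le b p \<longleftrightarrow> (\<forall>t\<in>Poly_Mapping.keys p. \<forall>v. Poly_Mapping.lookup t v \<le> b)"

lemma exponents_le_mono: "exponents_le a p \<Longrightarrow> a \<le> b \<Longrightarrow> exponents_le b p"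
  unfolding exponents_le_def using order_trans by blast

lemma exponents_le_ex: "\<exists>b. exponents_le b p"
proof -
  have "Poly_Mapping.lookup t v
      \<le> (\<Sum>t\<in>Poly_Mapping.keys p. \<Sum>v\<in>Poly_Mapping.keys t. Poly_Mapping.lookup t v)"
    if "t \<in> Poly_Mapping.keys p" for t v
  proof (cases "v \<in> Poly_Mapping.keys t")
    case True
    then have "Poly_Mapping.lookup t v \<le> (\<Sum>v\<in>Poly_Mapping.keys t. Poly_Mapping.lookup t v)"
      by (intro member_le_sum) auto
    also have "\<dots> \<le> (\<Sum>t\<in>Poly_Mapping.keys p. \<Sum>v\<in>Poly_Mapping.keys t. Poly_Mapping.lookup t v)"
      using that by (intro member_le_sum) auto
    finally show ?thesis .
  qed (simp add: Poly_Mapping.in_keys_iff)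
  then show ?thesis
    unfolding exponents_le_def by blast
qed

lemma exponents_le_mult:
  fixes p q :: "('v, 'k::comm_ring_1) mpolynomial"
  assumes "exponents_le a p" "exponents_le b q"
  shows "exponents_le (a + b) (p * q)"
  unfolding exponents_le_def
proof (intro ballI allI)
  fix t v assume "t \<in> Poly_Mapping.keys (p * q)"
  then obtain s u where "t = s + u" "s \<in> Poly_Mapping.keys p" "u \<in> Poly_Mapping.keys q"
    using keys_mult[of p q] by blast
  then show "Poly_Mapping.lookup t v \<le> a + b"
    using assms by (auto simp: exponents_le_def lookup_add intro: add_mono)
qed

lemma exponents_le_1: "exponents_le 0 (1 :: ('v, 'k::comm_ring_1) mpolynomial)"
  by (simp add: exponents_le_def)

lemma exponents_le_power:
  fixes p :: "('v, 'k::comm_ring_1) mpolynomial"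
  shows "exponents_le a p \<Longrightarrow> exponents_le (n * a) (p ^ n)"
  by (induction n) (auto intro: exponents_le_mult exponents_le_1)

lemma exponents_le_prod:
  fixes p :: "'a \<Rightarrow> ('v, 'k::comm_ring_1) mpolynomial"
  assumes "\<And>a. a \<in> A \<Longrightarrow> exponents_le (b a) (p a)"
  shows "exponents_le (\<Sum>a\<in>A. b a) (\<Prod>a\<in>A. p a)"
  using assms
  by (induction A rule: infinite_finite_induct) (auto intro: exponents_le_mult exponents_le_1)

text \<open>There are \<open>d ^ card U\<close> monomials in the \<open>x u\<close> with exponents below \<open>d\<close>, but they lie in a space
  whose dimension grows only like \<open>d ^ card X\<close>.\<close>

lemma algebraically_dependent:
  fixes x :: "'u \<Rightarrow> ('v, 'k::field) mpolynomial"
  assumes "finite X" "finite U" "card X < card U"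
    and x: "\<And>u. u \<in> U \<Longrightarrow> x u \<in> carrier (polynomial_ring X)"
  obtains Q where "Q \<in> carrier (polynomial_ring U)" "Q \<noteq> 0" "insertion x Q = 0"
proof -
  define N q where "N = card X" and "q = card U"
  have "\<forall>u. \<exists>b. exponents_le b (x u)"
    by (simp add: exponents_le_ex)
  then obtain b where b: "\<And>u. exponents_le (b u) (x u)"
    by metis
  define D where "D = (\<Sum>u\<in>U. b u)"
  have D: "exponents_le D (x u)" if "u \<in> U" for u
    unfolding D_def by (rule exponents_le_mono[OF b]) (use that assms in \<open>auto intro: member_le_sum\<close>)
  \<comment> \<open>The power products have exponents at most \<open>q * (d * D)\<close>, so they
    lie in a space of dimension \<open>(q * d * D + 1) ^ N\<close>, which is at most
    \<open>d ^ N * (q * D + 1) ^ N\<close>. This d exceeds the second factor, which leaves less than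
    \<open>d ^ Suc N\<close>, hence less than \<open>d ^ q\<close>.\<close>
  define d where "d = Suc ((q * D + 1) ^ N)"
  let ?G = "exponent_box U d" and ?S = "exponent_box X (q * (d * D) + 1)"
  have supp: "s \<in> ?S"
    if t: "t \<in> ?G" and s: "s \<in> Poly_Mapping.keys (power_product x t)" for s t
  proof -
    have tU: "Poly_Mapping.keys t \<subseteq> U"
      using t by (simp add: exponent_box_def)
    have "exponents_le (\<Sum>u\<in>U. Poly_Mapping.lookup t u * D) (power_product x t)"
      unfolding power_product_superset[OF assms(2) tU]
      by (intro exponents_le_prod exponents_le_power D)
    moreover have "(\<Sum>u\<in>U. Poly_Mapping.lookup t u * D) \<le> (\<Sum>u\<in>U. d * D)"
      using t by (intro sum_mono mult_right_mono) (auto simp: exponent_box_def less_imp_le)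
    ultimately have "exponents_le (q * (d * D)) (power_product x t)"
      by (auto intro: exponents_le_mono simp: q_def)
    moreover have "Poly_Mapping.keys s \<subseteq> X"
      using power_product_closed[of U x X t] x tU s by (auto simp: polynomial_ring_def)
    ultimately show ?thesis
      using s by (auto simp: exponent_box_def exponents_le_def less_Suc_eq_le)
  qed
  have "card ?S < card ?G"
  proof -
    have "(q * (d * D) + 1) ^ N \<le> (d * (q * D + 1)) ^ N"
      by (intro power_mono) (auto simp: algebra_simps d_def)
    also have "\<dots> = d ^ N * (q * D + 1) ^ N"
      by (rule power_mult_distrib)
    also have "\<dots> < d ^ N * d"
      by (simp add: d_def)
    also have "\<dots> = d ^ Suc N"
      by simp
    also have "\<dots> \<le> d ^ q"
      using assms by (intro power_increasing) (auto simp: N_def q_def d_def)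
    finally show ?thesis
      using assms by (simp add: exponent_box_card N_def q_def)
  qed
  moreover have "finite ?S" "finite ?G"
    using assms by (simp_all add: exponent_box_card)
  ultimately obtain c where c: "\<exists>t\<in>?G. c t \<noteq> 0"
    and eqs: "\<And>s. s \<in> ?S \<Longrightarrow> (\<Sum>t\<in>?G. c t * Poly_Mapping.lookup (power_product x t) s) = 0"
    using homogeneous_system_nontrivial_solution[of ?S ?G "\<lambda>t. Poly_Mapping.lookup (power_product x t)"]
    by metis
  \<comment> \<open>The coefficients of a nontrivial linear relation between the power products
    become those of the algebraic relation.\<close>
  define Q where "Q = (\<Sum>t\<in>?G. Poly_Mapping.single t (c t))"
  have Q: "Poly_Mapping.lookup Q t = (if t \<in> ?G then c t else 0)" for t
    using \<open>finite ?G\<close> by (simp add: Q_def lookup_sum lookup_single when_def)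
  show thesis
  proof
    show "Q \<in> carrier (polynomial_ring U)"
      by (auto simp: carrier_polynomial_ring_iff Q exponent_box_def)
    show "Q \<noteq> 0"
    proof
      assume "Q = 0"
      then have "c t = 0" if "t \<in> ?G" for t
        using Q[of t] that by simp
      then show False
        using c by blast
    qed
    show "insertion x Q = 0"
    proof (rule poly_mapping_eqI)
      fix s
      have "Poly_Mapping.lookup (insertion x Q) s
          = (\<Sum>t\<in>?G. c t * Poly_Mapping.lookup (power_product x t) s)"
        by (simp add: Q_def insertion_sum insertion_single lookup_sum lookup_const_mult)
      also have "\<dots> = 0"
      proof (cases "s \<in> ?S")
        case False
        then have "Poly_Mapping.lookup (power_product x t) s = 0" if "t \<in> ?G" for t
          using supp[OF that, of s] by (auto simp: Poly_Mapping.in_keys_iff)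
        then show ?thesis by simp
      qed (rule eqs)
      finally show "Poly_Mapping.lookup (insertion x Q) s = Poly_Mapping.lookup 0 s"
        by simp
    qed
  qed
qed

text \<open>Along a strict chain of primes the variable \<open>v\<close> can be eliminated from a relation: the value
  \<open>f v\<close> is not in \<open>C\<close>, so powers of \<open>v\<close> may be cancelled until a \<open>v\<close>-free term survives, and that
  one is a relation modulo \<open>C'\<close>.\<close>

lemma eliminate_variable:
  fixes Q :: "('u, 'k::comm_ring_1) mpolynomial" and f :: "'u \<Rightarrow> ('v, 'k) mpolynomial"
  assumes C: "primeideal C (polynomial_ring X)" and C': "ideal C' (polynomial_ring X)" "C \<subseteq> C'"
    and f: "\<And>u. u \<in> U \<Longrightarrow> f u \<in> carrier (polynomial_ring X)"
    and v: "v \<in> U" "f v \<in> C'" "f v \<notin> C"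
    and Q: "Q \<in> carrier (polynomial_ring U)" "Q \<noteq> 0" "insertion f Q \<in> C"
  obtains Q' where "Q' \<in> carrier (polynomial_ring (U - {v}))" "Q' \<noteq> 0" "insertion f Q' \<in> C'"
proof -
  interpret C: primeideal C "polynomial_ring X" by (rule C)
  interpret C': ideal C' "polynomial_ring X" by (rule C')
  obtain n where n: "(var_quotient v ^^ n) Q = 0"
    using var_quotient_nilpotent[of v Q] by blast
  have "\<exists>Q'. Q' \<in> carrier (polynomial_ring (U - {v})) \<and> Q' \<noteq> 0 \<and> insertion f Q' \<in> C'"
    using Q n
  proof (induction n arbitrary: Q)
    case (Suc n)
    have dec: "insertion f Q = insertion f (var_zero v Q) + f v * insertion f (var_quotient v Q)"
      by (subst var_zero_decomp[of Q v]) (simp only: insertion_add insertion_mult insertion_indeterminate)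
    have vq: "var_quotient v Q \<in> carrier (polynomial_ring U)"
      using Suc.prems by (intro polynomial_ring_var_quotient_closed)
    have c: "f v \<in> carrier (polynomial_ring X)"
      "insertion f (var_quotient v Q) \<in> carrier (polynomial_ring X)"
      using f v vq by (auto intro: insertion_closed[of U])
    show ?case
    proof (cases "var_zero v Q = 0")
      case True
      then have "f v * insertion f (var_quotient v Q) \<in> C"
        using Suc.prems(3) dec by simp
      then have "insertion f (var_quotient v Q) \<in> C"
        using C.I_prime[OF c] v by simp
      moreover have "var_quotient v Q \<noteq> 0"
        using Suc.prems(2) True var_zero_decomp[of Q v] by auto
      ultimately show ?thesis
        using Suc.IH[of "var_quotient v Q"] vq Suc.prems(4) by (simp add: funpow_swap1)
    next
      case False
      have "- insertion f (var_quotient v Q) \<in> carrier (polynomial_ring X)"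
        using c by (intro polynomial_ring_closed)
      then have "f v * - insertion f (var_quotient v Q) \<in> C'"
        using C'.I_r_closed[OF v(2)] by (simp only: ring_polynomial_ring)
      moreover have "insertion f Q \<in> C'"
        using Suc.prems(3) C'(2) by auto
      ultimately have "insertion f Q + f v * - insertion f (var_quotient v Q) \<in> C'"
        using C'.a_closed by (simp only: ring_polynomial_ring)
      moreover have "insertion f Q + f v * - insertion f (var_quotient v Q)
          = insertion f (var_zero v Q)"
        unfolding dec by (simp only: mult_minus_right add.right_inverse add.assoc add_0_right)
      ultimately have "insertion f (var_zero v Q) \<in> C'"
        by metis
      then show ?thesis
        using False polynomial_ring_var_zero_closed[OF Suc.prems(1)] by metis
    qed
  qed simp
  then show thesis
    using that by blast
qed

text \<open>In a chain of length h with \<open>h + r > card X\<close>, the \<open>z j\<close> and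
  one separating element per step are too many to be algebraically independent. Eliminating the
  separating elements while climbing the chain leaves a nonzero relation between the
  \<open>z j\<close> modulo P.\<close>

lemma prime_height_le:
  fixes P :: "('v, 'k::field) mpolynomial set"
  assumes X: "finite X"
    and z: "\<And>j. j < r \<Longrightarrow> z j \<in> carrier (polynomial_ring X)"
    and indep: "\<And>Q. Q \<in> carrier (polynomial_ring {..<r}) \<Longrightarrow> insertion z Q \<in> P \<Longrightarrow> Q = 0"
  shows "prime_height (polynomial_ring X) P \<le> enat (card X - r)"
  unfolding prime_height_def
proof (rule Sup_least)
  let ?R = "polynomial_ring X :: ('v, 'k) mpolynomial ring"
  fix e
  assume "e \<in> {enat h |h. \<exists>C. (\<forall>i\<le>h. primeideal (C i) ?R) \<and> (\<forall>i<h. C i \<subset> C (Suc i)) \<and> C h = P}"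
  then obtain h C where e: "e = enat h" and C: "\<And>i. i \<le> h \<Longrightarrow> primeideal (C i) ?R"
      "\<And>i. i < h \<Longrightarrow> C i \<subset> C (Suc i)" "C h = P"
    by blast
  have "h + r \<le> card X"
  proof (rule ccontr)
    assume "\<not> ?thesis"
    then have less: "card X < card {..<r + h}"
      by simp
    have "\<forall>i. \<exists>x. i < h \<longrightarrow> x \<in> C (Suc i) - C i"
      using C(2) by blast
    then obtain x where x: "\<And>i. i < h \<Longrightarrow> x i \<in> C (Suc i) - C i"
      by metis
    \<comment> \<open>Indices below r stand for the \<open>z j\<close>; index \<open>r + i\<close>
      stands for the element that separates \<open>C i\<close> from
      \<open>C (Suc i)\<close>.\<close>
    define f where "f j = (if j < r then z j else x (j - r))" for j
    have f: "f j \<in> carrier ?R" if "j < r + h" for j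
    proof (cases "j < r")
      case False
      then have "x (j - r) \<in> C (Suc (j - r))" "primeideal (C (Suc (j - r))) ?R"
        using that False x[of "j - r"] C(1)[of "Suc (j - r)"] by auto
      then show ?thesis
        using False ideal.Icarr[OF primeideal.axioms(1)] by (auto simp: f_def)
    qed (simp add: f_def z)
    obtain Q0 where Q0: "Q0 \<in> carrier (polynomial_ring {..<r + h})" "Q0 \<noteq> 0" "insertion f Q0 = 0"
      using algebraically_dependent[OF X _ less, of f] f by auto
    \<comment> \<open>At stage i the separating elements of the first i steps are gone, and the
      relation holds modulo \<open>C i\<close>.\<close>
    have "\<exists>Q. Q \<in> carrier (polynomial_ring ({..<r} \<union> {r + i..<r + h})) \<and> Q \<noteq> 0
        \<and> insertion f Q \<in> C i"
      if "i \<le> h" for i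
      using that
    proof (induction i)
      case 0
      have "0 \<in> C 0"
        using additive_subgroup.zero_closed[of "C 0" ?R] C(1)[of 0] 
        by (auto dest: primeideal.axioms(1) ideal.axioms(1))
      moreover have "{..<r} \<union> {r..<r + h} = {..<r + h}"
        by auto
      ultimately show ?case
        using Q0 by auto
    next
      case (Suc i)
      let ?U = "{..<r} \<union> {r + i..<r + h}"
      obtain Q where Q: "Q \<in> carrier (polynomial_ring ?U)" "Q \<noteq> 0" "insertion f Q \<in> C i"
        using Suc by auto
      have fi: "f (r + i) \<in> C (Suc i)" "f (r + i) \<notin> C i"
        using x[of i] Suc.prems by (auto simp: f_def)
      have C_i: "primeideal (C i) ?R" "ideal (C (Suc i)) ?R" "C i \<subseteq> C (Suc i)"
        using C(1)[of i] C(1)[of "Suc i"] C(2)[of i] Suc.prems by (auto dest: primeideal.axioms(1))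
      obtain Q' where "Q' \<in> carrier (polynomial_ring (?U - {r + i}))"
          "Q' \<noteq> 0" "insertion f Q' \<in> C (Suc i)"
      proof (rule eliminate_variable[OF C_i _ _ fi Q])
        show "f u \<in> carrier ?R" if "u \<in> ?U" for u
          using that Suc.prems by (intro f) auto
      qed (use Q Suc.prems in auto)
      moreover have "?U - {r + i} = {..<r} \<union> {r + Suc i..<r + h}"
        by auto
      ultimately show ?case
        by metis
    qed
    from this[of h] obtain Q where Q: "Q \<in> carrier (polynomial_ring {..<r})" "Q \<noteq> 0"
        "insertion f Q \<in> P"
      using C(3) by auto
    moreover have "insertion f Q = insertion z Q"
      by (rule insertion_cong[OF Q(1)]) (simp add: f_def)
    ultimately show False
      using indep by simp
  qed
  then show "e \<le> enat (card X - r)"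
    by (simp add: e)
qed


section \<open>Counting generators\<close>

text \<open>On the ideal J, multiplication by a polynomial acts on the coefficients at the monomials
  \<open>t h\<close> through its constant term alone, since no monomial of a \<open>p g\<close>
  properly divides a \<open>t h\<close>. So the coefficient vectors of any generating set span those
  of the \<open>p g\<close>, which are the unit vectors. This is the argument of Nakayama's lemma
  carried out on coefficients.\<close>

lemma min_num_generators_ge:
  fixes p :: "'g \<Rightarrow> ('v, 'k::field) mpolynomial" and t :: "'g \<Rightarrow> 'v \<Rightarrow>\<^sub>0 nat"
  defines "R X \<equiv> polynomial_ring X :: ('v, 'k) mpolynomial ring"
  assumes G: "finite G"
    and p: "\<And>g. g \<in> G \<Longrightarrow> p g \<in> carrier (R X)"
    and minimal: "\<And>g h s u. g \<in> G \<Longrightarrow> h \<in> G \<Longrightarrow> s \<in> Poly_Mapping.keys (p g) \<Longrightarrow> s + u = t h \<Longrightarrow> u = 0"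
    and lookup: "\<And>g h. g \<in> G \<Longrightarrow> h \<in> G \<Longrightarrow>
      Poly_Mapping.lookup (p g) (t h) = (if g = h then 1 else 0)"
  shows "enat (card G) \<le> min_num_generators (R X) (Idl\<^bsub>R X\<^esub> (p ` G))"
  unfolding min_num_generators_def
proof (rule Inf_greatest)
  let ?J = "Idl\<^bsub>R X\<^esub> (p ` G)"
  interpret R: cring "R X"
    unfolding R_def by (rule cring_polynomial_ring)
  have [simp]: "monoid.mult (R X) = (*)" "add (R X) = (+)" "zero (R X) = 0" "one (R X) = 1"
    by (simp_all add: R_def)
  fix e assume "e \<in> {enat (card S) |S. finite S \<and> S \<subseteq> carrier (R X) \<and> Idl\<^bsub>R X\<^esub> S = ?J}"
  then obtain S where e: "e = enat (card S)" and S: "finite S" "S \<subseteq> carrier (R X)" "Idl\<^bsub>R X\<^esub> S = ?J"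
    by blast
  \<comment> \<open>The polynomials none of whose monomials properly divides a \<open>t h\<close>.
    They form an ideal that contains J, hence also every generating set S of J.\<close>
  define L where "L = {q \<in> carrier (R X). \<forall>s\<in>Poly_Mapping.keys q. \<forall>h\<in>G. \<forall>u. s + u = t h \<longrightarrow> u = 0}"
  have sum_0: "a + b = 0 \<Longrightarrow> b = 0" for a b :: "'v \<Rightarrow>\<^sub>0 nat"
    by (metis add_is_0 lookup_add lookup_zero poly_mapping_eqI)
  have L_mult: "r * q \<in> L" if "q \<in> L" "r \<in> carrier (R X)" for q r
  proof -
    have "u = 0" if w: "w \<in> Poly_Mapping.keys (r * q)" and h: "h \<in> G" and eq: "w + u = t h"
        for w h u
    proof -
      obtain a s where "w = a + s" and s: "s \<in> Poly_Mapping.keys q"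
        using w keys_mult[of r q] by blast
      then have "s + (a + u) = t h"
        using eq by (simp add: ac_simps)
      then have "a + u = 0"
        using \<open>q \<in> L\<close> s h unfolding L_def by blast
      then show ?thesis
        by (rule sum_0)
    qed
    moreover have "r * q \<in> carrier (R X)"
      using that R.m_closed[of r q] by (simp add: L_def)
    ultimately show ?thesis
      by (simp add: L_def)
  qed
  have L_add: "q + q' \<in> L" if "q \<in> L" "q' \<in> L" for q q'
    using that keys_add[of q q'] R.a_closed[of q q'] by (fastforce simp: L_def)
  have L: "ideal L (R X)"
  proof (rule R.cring_idealI)
    show "\<zero>\<^bsub>R X\<^esub> \<in> L"
      using R.zero_closed by (simp add: L_def)
    show "L \<subseteq> carrier (R X)"
      by (auto simp: L_def)
  qed (simp_all add: L_mult L_add)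
  have "?J \<subseteq> L"
  proof (rule R.genideal_minimal[OF L], rule image_subsetI)
    fix g assume "g \<in> G"
    then show "p g \<in> L"
      unfolding L_def using p minimal by blast
  qed
  then have SL: "S \<subseteq> L"
    using R.genideal_self[OF S(2)] S(3) by blast
  \<comment> \<open>A nonconstant term of r could reach \<open>t h\<close> only from a proper
    divisor of \<open>t h\<close>, and q has no such monomial.\<close>
  have lookup_mult_L: "Poly_Mapping.lookup (r * q) (t h)
      = Poly_Mapping.lookup r 0 * Poly_Mapping.lookup q (t h)"
    if "q \<in> L" "h \<in> G" for r q h
  proof -
    have "(\<Sum>s. Poly_Mapping.lookup q s when t h = l + s) = (Poly_Mapping.lookup q (t h) when l = 0)" for l
    proof (cases "l = 0")
      case False
      have q_0: "Poly_Mapping.lookup q s = 0" if "t h = l + s" for s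
      proof (rule ccontr)
        assume "Poly_Mapping.lookup q s \<noteq> 0"
        then have "s \<in> Poly_Mapping.keys q"
          by (simp add: Poly_Mapping.in_keys_iff)
        moreover have "s + l = t h"
          using that by (simp add: add.commute)
        ultimately have "l = 0"
          using \<open>q \<in> L\<close> \<open>h \<in> G\<close> unfolding L_def by blast
        then show False
          using False by simp
      qed
      have "(\<Sum>s. Poly_Mapping.lookup q s when t h = l + s) = (\<Sum>s :: 'v \<Rightarrow>\<^sub>0 nat. 0)"
        by (intro Sum_any.cong) (simp add: when_def q_0)
      then show ?thesis
        using False by simp
    qed simp
    then show ?thesis
      by (simp add: lookup_mult mult_when)
  qed
  define rep where "rep q c \<longleftrightarrow> (\<forall>h\<in>G. Poly_Mapping.lookup q (t h)
      = (\<Sum>s\<in>S. c s * Poly_Mapping.lookup s (t h)))"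
    for q c
  \<comment> \<open>The elements whose coefficients at all \<open>t h\<close> are one common linear
    combination of those of S. This is an ideal containing S, so it contains J.\<close>
  define M where "M = {q \<in> L. \<exists>c. rep q c}"
  have M: "ideal M (R X)"
  proof (rule R.cring_idealI)
    show "M \<subseteq> carrier (R X)"
      by (auto simp: M_def L_def)
    have "0 \<in> L" "rep 0 (\<lambda>_. 0)"
      using additive_subgroup.zero_closed[OF ideal.axioms(1)[OF L]] by (simp_all add: rep_def)
    then show "\<zero>\<^bsub>R X\<^esub> \<in> M"
      unfolding M_def by auto
    show "a \<oplus>\<^bsub>R X\<^esub> b \<in> M" if ab: "a \<in> M" "b \<in> M" for a b
    proof -
      obtain c d where "rep a c" "rep b d"
        using ab unfolding M_def by blast
      then have "rep (a + b) (\<lambda>s. c s + d s)"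
        by (simp add: rep_def lookup_add distrib_right sum.distrib)
      then show ?thesis
        using ab L_add unfolding M_def by auto
    qed
    show "x \<otimes>\<^bsub>R X\<^esub> a \<in> M" if a: "a \<in> M" and x: "x \<in> carrier (R X)" for a x
    proof -
      obtain c where c: "a \<in> L" "rep a c"
        using a unfolding M_def by blast
      then have "rep (x * a) (\<lambda>s. Poly_Mapping.lookup x 0 * c s)"
        by (simp add: rep_def lookup_mult_L sum_distrib_left mult.assoc)
      then show ?thesis
        using L_mult[OF c(1) x] unfolding M_def by auto
    qed
  qed
  have "S \<subseteq> M"
  proof
    fix s assume s: "s \<in> S"
    have "Poly_Mapping.lookup s (t h) = (\<Sum>s'\<in>S. (if s' = s then 1 else 0) * Poly_Mapping.lookup s' (t h))" for h
      using s S(1) by (simp add: if_distrib[of "\<lambda>c. c * _"] cong: if_cong)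
    then have "rep s (\<lambda>s'. if s' = s then 1 else 0)"
      unfolding rep_def by blast
    then show "s \<in> M"
      using SL s unfolding M_def by blast
  qed
  then have "?J \<subseteq> M"
    using R.genideal_minimal[OF M] S(3) by metis
  then have "p g \<in> M" if "g \<in> G" for g
    using R.genideal_self[of "p ` G"] p that by blast
  then have "\<forall>g\<in>G. \<exists>c. \<forall>h\<in>G. Poly_Mapping.lookup (p g) (t h)
      = (\<Sum>s\<in>S. c s * Poly_Mapping.lookup s (t h))"
    unfolding M_def rep_def by blast
  then obtain c where c: "\<And>g h. g \<in> G \<Longrightarrow> h \<in> G \<Longrightarrow>
      Poly_Mapping.lookup (p g) (t h) = (\<Sum>s\<in>S. c g s * Poly_Mapping.lookup s (t h))"
    by metis
  have "card G \<le> card S"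
  proof (rule ccontr)
    assume "\<not> ?thesis"
    \<comment> \<open>With fewer generators than \<open>p g\<close>, the rows of coefficients
      \<open>c g\<close> are linearly dependent. The same dependence between the unit vectors then
      forces u to vanish.\<close>
    then obtain u where u: "\<exists>g\<in>G. u g \<noteq> 0" "\<And>s. s \<in> S \<Longrightarrow> (\<Sum>g\<in>G. u g * c g s) = 0"
      using homogeneous_system_nontrivial_solution[OF S(1) G, of c] by auto
    have "u h = 0" if h: "h \<in> G" for h
    proof -
      have "u h = (\<Sum>g\<in>G. u g * Poly_Mapping.lookup (p g) (t h))"
        using G h by (simp add: lookup if_distrib cong: if_cong)
      also have "\<dots> = (\<Sum>g\<in>G. \<Sum>s\<in>S. u g * c g s * Poly_Mapping.lookup s (t h))"
        using h by (simp add: c sum_distrib_left mult.assoc)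
      also have "\<dots> = (\<Sum>s\<in>S. (\<Sum>g\<in>G. u g * c g s) * Poly_Mapping.lookup s (t h))"
        by (subst sum.swap) (simp add: sum_distrib_right)
      also have "\<dots> = 0"
        using u(2) by simp
      finally show ?thesis .
    qed
    then show False
      using u(1) by blast
  qed
  then show "enat (card G) \<le> e"
    by (simp add: e)
qed


section \<open>Regular sequences of consecutive minors\<close>

text \<open>The closure of I under division by x and y expresses that I is extended from the
  polynomials free of both. Modulo such an ideal, \<open>a * y - b * x\<close> is a linear form in
  two fresh variables, with a cancellable leading coefficient.\<close>

context
  fixes X :: "'v set" and I :: "('v, 'k::comm_ring_1) mpolynomial set"
    and a b :: "('v, 'k) mpolynomial" and x y :: 'v
  assumes I: "ideal I (polynomial_ring X)"
    and xy: "x \<in> X" "y \<in> X" "x \<noteq> y"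
    and quotient_x: "\<And>p. p \<in> I \<Longrightarrow> var_quotient x p \<in> I"
    and quotient_y: "\<And>p. p \<in> I \<Longrightarrow> var_quotient y p \<in> I"
    and a: "a \<in> carrier (polynomial_ring (X - {x, y}))"
    and b: "b \<in> carrier (polynomial_ring (X - {x, y}))"
    and a_nzd: "\<And>g. g \<in> carrier (polynomial_ring X) \<Longrightarrow> a * g \<in> I \<Longrightarrow> g \<in> I"
begin

interpretation I: ideal I "polynomial_ring X" by (rule I)

abbreviation (input) "linear_form \<equiv> a * indeterminate y - b * indeterminate x"

private lemma carrier:
  "a \<in> carrier (polynomial_ring X)" "b \<in> carrier (polynomial_ring X)"
  "indeterminate x \<in> carrier (polynomial_ring X)" "indeterminate y \<in> carrier (polynomial_ring X)"
  using a b xy polynomial_ring_mono[of "X - {x, y}" X] by (auto intro: polynomial_ring_closed)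

private lemma I_add: "p \<in> I \<Longrightarrow> q \<in> I \<Longrightarrow> p + q \<in> I"
  using additive_subgroup.a_closed[OF I.additive_subgroup_axioms, of p q] by simp

private lemma I_mult: "p \<in> I \<Longrightarrow> r \<in> carrier (polynomial_ring X) \<Longrightarrow> r * p \<in> I"
  using I.I_l_closed by simp

private lemma I_uminus: "p \<in> I \<Longrightarrow> - p \<in> I"
  using I_mult[of p "- 1"] by (simp add: polynomial_ring_closed)

private lemma I_diff: "p \<in> I \<Longrightarrow> q \<in> I \<Longrightarrow> p - q \<in> I"
  using I_add[of p "- q"] I_uminus by simp

text \<open>Division by x with remainder: by \<open>quotient_free\<close> the first summand is free
  of x.\<close>

private lemma linear_form_mult:
  "linear_form * g = a * indeterminate y * var_zero x g
    + indeterminate x * (a * indeterminate y * var_quotient x g - b * g)"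
proof -
  have "linear_form * g = a * indeterminate y * g - indeterminate x * (b * g)"
    by (simp add: algebra_simps)
  also have "a * indeterminate y * g = a * indeterminate y * var_zero x g
      + indeterminate x * (a * indeterminate y * var_quotient x g)"
    by (subst var_zero_decomp[of g x]) (simp add: algebra_simps)
  finally show ?thesis
    by (simp add: algebra_simps)
qed

private lemma quotient_free:
  assumes "g \<in> carrier (polynomial_ring X)"
  shows "var_quotient x (a * indeterminate y * var_zero x g) = 0"
proof (rule var_quotient_eq_0[of _ "X - {x}"])
  have "a \<in> carrier (polynomial_ring (X - {x}))"
    using a polynomial_ring_mono[of "X - {x, y}" "X - {x}"] by auto
  then show "a * indeterminate y * var_zero x g \<in> carrier (polynomial_ring (X - {x}))"
    using assms xy by (intro polynomial_ring_closed polynomial_ring_var_zero_closed) auto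
qed simp

text \<open>The factor y is removed by \<open>quotient_y\<close> and the factor a by
  \<open>a_nzd\<close>.\<close>

private lemma var_zero_mem:
  assumes "g \<in> carrier (polynomial_ring X)" "a * indeterminate y * var_zero x g \<in> I"
  shows "var_zero x g \<in> I"
proof -
  have "var_zero x g \<in> carrier (polynomial_ring X)"
    using polynomial_ring_var_zero_closed[OF assms(1), of x] polynomial_ring_mono[of "X - {x}" X]
        by auto
  moreover have "var_quotient y (indeterminate y * (a * var_zero x g)) \<in> I"
    using assms(2) by (intro quotient_y) (simp add: ac_simps)
  ultimately show ?thesis
    by (intro a_nzd[of "var_zero x g"]) simp_all
qed

text \<open>The \<open>x\<close>-free part of a multiple of the linear form by \<open>g\<close> is \<open>a * y\<close> times that of \<open>g\<close>; so the
  \<open>x\<close>-free part of \<open>g\<close> lies in \<open>I\<close> and can be subtracted.\<close>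

lemma linear_form_nonzerodivisor:
  assumes "g \<in> carrier (polynomial_ring X)" "linear_form * g \<in> I"
  shows "g \<in> I"
proof -
  obtain n where n: "(var_quotient x ^^ n) g = 0"
    using var_quotient_nilpotent[of x g] by blast
  from assms n show ?thesis
  proof (induction n arbitrary: g)
    case 0
    then show ?case
      using I.zero_closed by simp
  next
    case (Suc n)
    let ?h = "a * indeterminate y * var_quotient x g - b * g"
    have q: "var_quotient x g \<in> carrier (polynomial_ring X)"
      using Suc.prems(1) by (rule polynomial_ring_var_quotient_closed)
    have "?h \<in> I"
      using quotient_x[OF Suc.prems(2)] quotient_free[OF Suc.prems(1)]
      by (simp add: linear_form_mult[of g] var_quotient_add)
    then have "linear_form * g - indeterminate x * ?h \<in> I"
      by (intro I_diff[OF Suc.prems(2)] I_mult carrier(3))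
    then have "a * indeterminate y * var_zero x g \<in> I"
      unfolding linear_form_mult[of g] by simp
    then have zero: "var_zero x g \<in> I"
      using Suc.prems(1) by (intro var_zero_mem)
    \<comment> \<open>What is left is x times the multiple of the form by the quotient of g, so one
      division by x reduces to the induction hypothesis.\<close>
    have "linear_form * g - linear_form * var_zero x g
        = indeterminate x * (linear_form * var_quotient x g)"
      by (subst var_zero_decomp[of g x]) (simp add: algebra_simps)
    moreover have "linear_form * g - linear_form * var_zero x g \<in> I"
      by (intro I_diff[OF Suc.prems(2)] I_mult[OF zero] polynomial_ring_closed carrier)
    ultimately have "linear_form * var_quotient x g \<in> I"
      using quotient_x[of "indeterminate x * (linear_form * var_quotient x g)"] by simp
    then have "var_quotient x g \<in> I"
      using Suc.IH[OF q] Suc.prems(3) by (simp add: funpow_swap1)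
    then have "var_zero x g + indeterminate x * var_quotient x g \<in> I"
      by (intro I_add zero I_mult carrier(3))
    then show ?case
      using var_zero_decomp[of g x] by simp
  qed
qed

text \<open>This makes x cancellable modulo I and the linear form, so x can be the leading
  coefficient of the next form. Dividing the equation by x expresses g, and its x-free part shows
  that the x-free part of h lies in I. That part is moved into \<open>i'\<close>, and the rest of h
  supplies the multiple of the form.\<close>

lemma indeterminate_nonzerodivisor_linear_form:
  assumes "i \<in> I" "h \<in> carrier (polynomial_ring X)"
    and eq: "indeterminate x * g = i + linear_form * h"
  shows "\<exists>i'\<in>I. \<exists>h'\<in>carrier (polynomial_ring X). g = i' + linear_form * h'"
proof (intro bexI)
  let ?h = "a * indeterminate y * var_quotient x h - b * h"
  have g: "g = var_quotient x i + ?h"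
    using arg_cong[OF eq, of "var_quotient x"] quotient_free[OF assms(2)]
    by (simp add: linear_form_mult[of h] var_quotient_add)
  have "a * indeterminate y * var_zero x h = indeterminate x * g - i - indeterminate x * ?h"
    using eq unfolding linear_form_mult[of h] by (simp add: algebra_simps)
  also have "\<dots> = indeterminate x * var_quotient x i - i"
    by (simp add: g algebra_simps)
  also have "\<dots> \<in> I"
    using assms(1) carrier(3) by (intro I_diff I_mult quotient_x)
  finally have "var_zero x h \<in> I"
    using assms(2) by (intro var_zero_mem)
  then show "var_quotient x i - b * var_zero x h \<in> I"
    using assms(1) carrier(2) by (intro I_diff I_mult quotient_x)
  show "g = var_quotient x i - b * var_zero x h + linear_form * var_quotient x h"
    unfolding g by (subst (2) var_zero_decomp[of h x]) (simp add: algebra_simps)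
  show "var_quotient x h \<in> carrier (polynomial_ring X)"
    using assms(2) by (rule polynomial_ring_var_quotient_closed)
qed

end

text \<open>The minor \<open>f k\<close> is a linear form in \<open>x (Suc k)\<close> and
  \<open>y (Suc k)\<close>, which do not occur in the earlier minors; its coefficients are
  \<open>x k\<close> and \<open>y k\<close>. Cancelling \<open>x k\<close> modulo the earlier minors
  is thus all that is needed to cancel \<open>f k\<close>.\<close>

lemma prime_height_consecutive_minors:
  fixes x y :: "nat \<Rightarrow> 'v" and P :: "('v, 'k::comm_ring_1) mpolynomial set"
  defines "f k \<equiv> indeterminate (x k) * indeterminate (y (Suc k))
      - indeterminate (y k) * indeterminate (x (Suc k))"
  assumes inj: "inj_on x {..r}" "inj_on y {..r}" "x ` {..r} \<inter> y ` {..r} = {}"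
    and X: "x ` {..r} \<subseteq> X" "y ` {..r} \<subseteq> X"
    and P: "primeideal P (polynomial_ring X)" "\<And>k. k < r \<Longrightarrow> f k \<in> P"
  shows "enat r \<le> prime_height (polynomial_ring X) P"
proof -
  let ?R = "polynomial_ring X :: ('v, 'k) mpolynomial ring"
  interpret R: cring ?R by (rule cring_polynomial_ring)
  interpret P: primeideal P ?R by (rule P)
  \<comment> \<open>The ideal of the first k minors, built recursively so that membership comes with
    an explicit decomposition.\<close>
  define I where "I = rec_nat {0} (\<lambda>k A. {i + f k * h | i h. i \<in> A \<and> h \<in> carrier ?R})"
  have I_0: "I 0 = {0}"
    and I_Suc: "I (Suc k) = {i + f k * h | i h. i \<in> I k \<and> h \<in> carrier ?R}" for k
    by (simp_all add: I_def)
  have I_SucI: "i + f k * h \<in> I (Suc k)" if "i \<in> I k" "h \<in> carrier ?R" for i h k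
    using that by (auto simp: I_Suc)
  have I_SucE: "\<exists>i h. a = i + f k * h \<and> i \<in> I k \<and> h \<in> carrier ?R" if "a \<in> I (Suc k)" for a k
    using that by (auto simp: I_Suc)
  have x_eq: "x i = x j \<longleftrightarrow> i = j" and y_eq: "y i = y j \<longleftrightarrow> i = j"
    and xy: "x i \<noteq> y j" "y j \<noteq> x i" if "i \<le> r" "j \<le> r" for i j
    using that inj by (auto dest: inj_onD)
  have xX: "x i \<in> X" and yX: "y i \<in> X" if "i \<le> r" for i
    using that X by auto
  have f_closed: "f k \<in> carrier (polynomial_ring Y)"
    if "{x k, x (Suc k), y k, y (Suc k)} \<subseteq> Y" for k Y
    using that unfolding f_def by (intro polynomial_ring_closed) auto
  have ideal: "ideal (I k) ?R" if "k \<le> r" for k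
    using that
  proof (induction k)
    case 0
    then show ?case
      using R.zeroideal by (simp add: I_0)
  next
    case (Suc k)
    then interpret I: ideal "I k" ?R by simp
    have fk: "f k \<in> carrier ?R"
      using Suc.prems xX yX by (intro f_closed) auto
    show ?case
    proof (rule R.cring_idealI)
      show "I (Suc k) \<subseteq> carrier ?R"
        unfolding I_Suc using fk I.Icarr by (auto intro!: polynomial_ring_closed)
      show "\<zero>\<^bsub>?R\<^esub> \<in> I (Suc k)"
        using I_SucI[of 0 k 0] I.zero_closed R.zero_closed by simp
      show "a \<oplus>\<^bsub>?R\<^esub> b \<in> I (Suc k)" if ab: "a \<in> I (Suc k)" "b \<in> I (Suc k)" for a b
      proof -
        obtain i h where a: "a = i + f k * h" "i \<in> I k" "h \<in> carrier ?R"
          using I_SucE[OF ab(1)] by metis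
        obtain i' h' where b: "b = i' + f k * h'" "i' \<in> I k" "h' \<in> carrier ?R"
          using I_SucE[OF ab(2)] by metis
        have "i + i' \<in> I k" "h + h' \<in> carrier ?R"
          using additive_subgroup.a_closed[OF I.additive_subgroup_axioms, of i i'] a b
          by (auto intro: polynomial_ring_closed)
        moreover have "a + b = (i + i') + f k * (h + h')"
          by (simp add: a(1) b(1) algebra_simps)
        ultimately show ?thesis
          unfolding ring_polynomial_ring by (metis I_SucI)
      qed
      show "p \<otimes>\<^bsub>?R\<^esub> a \<in> I (Suc k)" if a: "a \<in> I (Suc k)" and p: "p \<in> carrier ?R" for a p
      proof -
        obtain i h where ih: "a = i + f k * h" "i \<in> I k" "h \<in> carrier ?R"
          using I_SucE[OF a] by metis
        have "p * i \<in> I k" "p * h \<in> carrier ?R"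
          using I.I_l_closed[OF ih(2) p] ih p by (auto intro: polynomial_ring_closed)
        moreover have "p * a = p * i + f k * (p * h)"
          by (simp add: ih(1) algebra_simps)
        ultimately show ?thesis
          unfolding ring_polynomial_ring by (metis I_SucI)
      qed
    qed
  qed
  \<comment> \<open>The minors generating \<open>I k\<close> involve only columns up to k, so
    division by a variable of a later column acts on the multipliers alone.\<close>
  have quotient: "var_quotient v p \<in> I k"
    if "p \<in> I k" "k < j" "j \<le> r" "v = x j \<or> v = y j" for v p k j
    using that
  proof (induction k arbitrary: p)
    case (Suc k)
    obtain i h where p: "p = i + f k * h" "i \<in> I k" "h \<in> carrier ?R"
      using I_SucE[OF Suc.prems(1)] by metis
    have "{x k, x (Suc k), y k, y (Suc k)} \<subseteq> X - {v}"
      using Suc.prems x_eq y_eq xy xX yX by auto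
    then have "var_quotient v p = var_quotient v i + f k * var_quotient v h"
      using var_quotient_mult[OF f_closed, of k "X - {v}" v h] p(1) by (simp add: var_quotient_add)
    moreover have "var_quotient v i \<in> I k" "var_quotient v h \<in> carrier ?R"
      using Suc.IH[OF p(2)] Suc.prems p(3) by (auto intro: polynomial_ring_var_quotient_closed)
    ultimately show ?case
      by (simp add: I_SucI)
  qed (simp add: I_0)
  have coeffs: "indeterminate (x k) \<in> carrier (polynomial_ring (X - {x (Suc k), y (Suc k)}))"
      "indeterminate (y k) \<in> carrier (polynomial_ring (X - {x (Suc k), y (Suc k)}))"
    if "k < r" for k
    using that x_eq y_eq xy xX yX by (auto intro!: polynomial_ring_indeterminate_closed)
  \<comment> \<open>Induction along the path: cancelling \<open>x k\<close> modulo
    \<open>I k\<close> allows \<open>x (Suc k)\<close> to be cancelled modulo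
    \<open>I (Suc k)\<close>.\<close>
  have x_nzd: "g \<in> I k" if "g \<in> carrier ?R" "indeterminate (x k) * g \<in> I k" "k \<le> r" for g k
    using that
  proof (induction k arbitrary: g)
    case 0
    then have "var_quotient (x 0) (indeterminate (x 0) * g) = 0"
      by (simp only: I_0 singleton_iff var_quotient_0)
    then show ?case
      by (simp add: I_0)
  next
    case (Suc k)
    obtain i h where ih: "indeterminate (x (Suc k)) * g = i + f k * h" "i \<in> I k" "h \<in> carrier ?R"
      using I_SucE[OF Suc.prems(2)] by metis
    have "k \<le> r" "k < r" using Suc.prems by auto
    have "\<exists>i'\<in>I k. \<exists>h'\<in>carrier ?R. g = i' + f k * h'"
      unfolding f_def
    proof (rule indeterminate_nonzerodivisor_linear_form[OF ideal[OF \<open>k \<le> r\<close>]])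
      show "indeterminate (x (Suc k)) * g = i + (indeterminate (x k) * indeterminate (y (Suc k))
          - indeterminate (y k) * indeterminate (x (Suc k))) * h"
        using ih(1) by (simp add: f_def)
      show "var_quotient (x (Suc k)) p \<in> I k" "var_quotient (y (Suc k)) p \<in> I k" if "p \<in> I k" for p
        using that Suc.prems by (auto intro: quotient)
    qed (use ih Suc coeffs[OF \<open>k < r\<close>] xX yX xy in auto)
    then show ?case
      using I_SucI by blast
  qed
  have sub: "I k \<subseteq> I (Suc k)" and f_mem: "f k \<in> I (Suc k)" if "k < r" for k
  proof -
    have "i + f k * 0 \<in> I (Suc k)" if "i \<in> I k" for i
      using that by (intro I_SucI polynomial_ring_zero_closed)
    then show "I k \<subseteq> I (Suc k)"
      by auto
    have "0 \<in> I k"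
      using additive_subgroup.zero_closed[OF ideal.axioms(1)[OF ideal]] that by force
    then have "0 + f k * 1 \<in> I (Suc k)"
      by (intro I_SucI polynomial_ring_one_closed)
    then show "f k \<in> I (Suc k)"
      by simp
  qed
  show ?thesis
  proof (rule R.prime_height_ge[of r I])
    show "\<exists>f\<in>I (Suc k). \<forall>g\<in>carrier ?R. f \<otimes>\<^bsub>?R\<^esub> g \<in> I k \<longrightarrow> g \<in> I k" if k: "k < r" for k
    proof (intro bexI[of _ "f k"] ballI impI f_mem[OF k])
      fix g assume g: "g \<in> carrier ?R" "f k \<otimes>\<^bsub>?R\<^esub> g \<in> I k"
      have "k \<le> r" using k by simp
      show "g \<in> I k"
      proof (rule linear_form_nonzerodivisor[OF ideal[OF \<open>k \<le> r\<close>] _ _ _ _ _ coeffs[OF k] _ g(1)])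
        show "(indeterminate (x k) * indeterminate (y (Suc k))
          - indeterminate (y k) * indeterminate (x (Suc k))) * g \<in> I k"
          using g(2) by (simp add: f_def)
        show "var_quotient (x (Suc k)) p \<in> I k" "var_quotient (y (Suc k)) p \<in> I k" if "p \<in> I k"
            for p
          using that k by (auto intro: quotient)
      qed (use k xX yX xy x_nzd in auto)
    qed
    have "I k \<subseteq> P" if "k \<le> r" for k
      using that
    proof (induction k)
      case 0
      then show ?case
        using P.zero_closed by (simp add: I_0)
    next
      case (Suc k)
      have "i + f k * h \<in> P" if "i \<in> I k" "h \<in> carrier ?R" for i h
        using additive_subgroup.a_closed[OF P.additive_subgroup_axioms, of i "f k * h"]
          P.I_r_closed[OF P(2) that(2), of k] Suc that by auto
      then show ?case
        by (auto simp: I_Suc)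
    qed
    then show "I r \<subseteq> P"
      by simp
  qed (use ideal sub P in auto)
qed


section \<open>Kernels of monomial parametrizations\<close>

lemma insertion_const [simp]: "insertion f (Poly_Mapping.single 0 c) = Poly_Mapping.single 0 c"
  by (simp add: insertion_single power_product_def)

lemma insertion_1 [simp]: "insertion f 1 = 1"
  using insertion_const[of f 1] by simp

lemma insertion_power: "insertion f (p ^ n) = insertion f p ^ n"
  by (induction n) (simp_all add: insertion_mult)

lemma insertion_prod: "insertion f (\<Prod>a\<in>A. g a) = (\<Prod>a\<in>A. insertion f (g a))"
  by (induction A rule: infinite_finite_induct) (simp_all add: insertion_mult)

lemma insertion_insertion: "insertion f (insertion g p) = insertion (\<lambda>u. insertion f (g u)) p"
  by (simp add: insertion_def[of g] insertion_def[of "\<lambda>u. insertion f (g u)"] insertion_sum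
      insertion_mult power_product_def insertion_prod insertion_power)

text \<open>The kernel of a homomorphism into an integral domain. The order on the target variables
  induces one on monomials, through which the target is known to be a domain.\<close>

lemma primeideal_insertion_kernel:
  fixes f :: "'v \<Rightarrow> ('w::linorder, 'k::field) mpolynomial"
  shows "primeideal {p \<in> carrier (polynomial_ring X). insertion f p = 0} (polynomial_ring X)"
proof -
  let ?P = "{p \<in> carrier (polynomial_ring X). insertion f p = 0}"
  interpret R: cring "polynomial_ring X :: ('v, 'k) mpolynomial ring"
    by (rule cring_polynomial_ring)
  have "1 \<in> carrier (polynomial_ring X) - ?P"
    by (simp add: polynomial_ring_one_closed)
  then have "carrier (polynomial_ring X) \<noteq> ?P"
    by blast
  moreover have "ideal ?P (polynomial_ring X)"
    by (rule R.cring_idealI)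
      (auto simp: insertion_add insertion_mult intro: polynomial_ring_closed)
  ultimately show ?thesis
    by (intro primeidealI R.is_cring) (auto simp: insertion_mult)
qed

text \<open>By \<open>indep\<close>, distinct monomials of Q are sent to distinct monomials, so no
  terms can cancel.\<close>

lemma insertion_monomials_eq_0:
  fixes f :: "'u \<Rightarrow> ('w, 'k::comm_ring_1) mpolynomial"
  assumes U: "finite U" and f: "\<And>u. u \<in> U \<Longrightarrow> f u = Poly_Mapping.single (\<mu> u) 1"
    and indep: "\<And>a b :: 'u \<Rightarrow> nat.
      (\<And>w. (\<Sum>u\<in>U. a u * Poly_Mapping.lookup (\<mu> u) w) = (\<Sum>u\<in>U. b u * Poly_Mapping.lookup (\<mu> u) w))
      \<Longrightarrow> \<forall>u\<in>U. a u = b u"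
    and Q: "Q \<in> carrier (polynomial_ring U)" "insertion f Q = 0"
  shows "Q = 0"
proof -
  \<comment> \<open>The exponent vector of the image of the monomial t.\<close>
  define M where "M t = (\<Sum>u\<in>U. Poly_Mapping.map ((*) (Poly_Mapping.lookup t u)) (\<mu> u))" for t
  have lookup_map: "Poly_Mapping.lookup (Poly_Mapping.map ((*) n) s) w
      = n * Poly_Mapping.lookup s w"
    for n :: nat and s :: "'w \<Rightarrow>\<^sub>0 nat" and w
    by (simp add: Poly_Mapping.map.rep_eq when_def)
  have power: "Poly_Mapping.single s 1 ^ n
      = (Poly_Mapping.single (Poly_Mapping.map ((*) n) s) 1 :: ('w, 'k) mpolynomial)"
    for s n
  proof (induction n)
    case 0
    have "Poly_Mapping.map ((*) 0) s = 0"
      by (rule poly_mapping_eqI) (simp only: lookup_map lookup_zero mult_0)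
    then show ?case
      by (simp only: power_0 single_one)
  next
    case (Suc n)
    have "Poly_Mapping.map ((*) (Suc n)) s = s + Poly_Mapping.map ((*) n) s"
      by (rule poly_mapping_eqI) (simp add: lookup_map lookup_add)
    then show ?case
      by (simp only: Suc power_Suc mult_single mult_1)
  qed
  have prod: "(\<Prod>u\<in>A. Poly_Mapping.single (g u) 1)
      = (Poly_Mapping.single (\<Sum>u\<in>A. g u) 1 :: ('w, 'k) mpolynomial)"
    for A :: "'u set" and g
    by (induction A rule: infinite_finite_induct) (simp_all add: mult_single)
  have pp: "power_product f t = Poly_Mapping.single (M t) 1" if "Poly_Mapping.keys t \<subseteq> U" for t
    unfolding power_product_superset[OF U that] M_def prod[symmetric]
    by (intro prod.cong) (simp_all add: f power)
  have inj: "s = t" if "M s = M t" "Poly_Mapping.keys s \<subseteq> U" "Poly_Mapping.keys t \<subseteq> U" for s t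
  proof -
    have "\<forall>u\<in>U. Poly_Mapping.lookup s u = Poly_Mapping.lookup t u"
    proof (rule indep)
      fix w
      show "(\<Sum>u\<in>U. Poly_Mapping.lookup s u * Poly_Mapping.lookup (\<mu> u) w)
          = (\<Sum>u\<in>U. Poly_Mapping.lookup t u * Poly_Mapping.lookup (\<mu> u) w)"
        using arg_cong[OF that(1), of "\<lambda>m. Poly_Mapping.lookup m w"]
        by (simp add: M_def lookup_sum lookup_map)
    qed
    then show ?thesis
      using that(2,3) by (intro poly_mapping_eqI) (metis Poly_Mapping.in_keys_iff subsetD)
  qed
  have keys: "Poly_Mapping.keys t \<subseteq> U" if "t \<in> Poly_Mapping.keys Q" for t
    using Q(1) that by (auto simp: polynomial_ring_def)
  have "Poly_Mapping.lookup Q t = 0" if t: "t \<in> Poly_Mapping.keys Q" for t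
  proof -
    have "0 = Poly_Mapping.lookup (insertion f Q) (M t)"
      using Q by simp
    also have "\<dots> = (\<Sum>s\<in>Poly_Mapping.keys Q. Poly_Mapping.lookup Q s * (1 when M s = M t))"
      by (simp add: insertion_def lookup_sum lookup_const_mult pp keys lookup_single)
    also have "\<dots> = (\<Sum>s\<in>Poly_Mapping.keys Q. if s = t then Poly_Mapping.lookup Q s else 0)"
      using keys t inj by (intro sum.cong) (auto simp: when_def)
    finally show ?thesis
      using t by simp
  qed
  then show ?thesis
    by (intro poly_mapping_eqI) (metis Poly_Mapping.in_keys_iff lookup_zero)
qed


section \<open>Graphs\<close>

text \<open>Start with every vertex as its own label and add the edges one by one. A new edge gives
  the class of b the label of the class of a, so at most one label is lost per edge.\<close>

lemma component_labelling:
  assumes "finite V" "finite E" "simple_graph V E"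
  shows "\<exists>c. (\<forall>v\<in>V. c v \<in> V \<and> c (c v) = c v) \<and> (\<forall>u v. {u, v} \<in> E \<longrightarrow> c u = c v)
      \<and> card V \<le> card (c ` V) + card E"
  using assms(2,3)
proof (induction E rule: finite_induct)
  case empty
  then show ?case
    by (intro exI[of _ id]) auto
next
  case (insert e E)
  then obtain c where c: "\<forall>v\<in>V. c v \<in> V \<and> c (c v) = c v" "\<forall>u v. {u, v} \<in> E \<longrightarrow> c u = c v"
      "card V \<le> card (c ` V) + card E"
    by (auto simp: simple_graph_def)
  have "card e = 2" "e \<subseteq> V"
    using insert.prems by (auto simp: simple_graph_def)
  then obtain a b where e: "e = {a, b}" "a \<in> V" "b \<in> V"
    by (auto simp: card_2_iff)
  define c' where "c' v = (if c v = c b then c a else c v)" for v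
  have "c' v \<in> V \<and> c' (c' v) = c' v" if "v \<in> V" for v
    using c(1) e that by (auto simp: c'_def)
  moreover have "c' u = c' v" if "{u, v} \<in> insert e E" for u v
    using c(2) e that by (auto simp: c'_def doubleton_eq_iff)
  moreover have "c ` V \<subseteq> insert (c b) (c' ` V)"
    by (auto simp: c'_def)
  then have "card (c ` V) \<le> card (insert (c b) (c' ` V))"
    using assms(1) by (intro card_mono) auto
  then have "card (c ` V) \<le> Suc (card (c' ` V))"
    using card_insert_le_m1[of "Suc (card (c' ` V))" "c' ` V" "c b"] by simp
  then have "card V \<le> card (c' ` V) + card (insert e E)"
    using c(3) insert by simp
  ultimately show ?case
    by (intro exI[of _ c']) blast
qed

lemma connected_graph_closed:
  assumes "connected_graph V E" "u \<in> V" "P u" "v \<in> V"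
    and "\<And>a b. P a \<Longrightarrow> {a, b} \<in> E \<Longrightarrow> P b"
  shows "P v"
proof -
  have "(u, v) \<in> {(a, b). {a, b} \<in> E}\<^sup>*"
    using assms by (auto simp: connected_graph_def)
  then show ?thesis
  proof (induction rule: rtrancl_induct)
    case (step a b)
    then show ?case
      using assms(5)[of a b] by simp
  qed (rule assms(3))
qed

lemma connected_graph_label_const:
  assumes "connected_graph V E" "\<And>u v. {u, v} \<in> E \<Longrightarrow> c u = c v" "u \<in> V" "v \<in> V"
  shows "c v = c u"
proof (rule connected_graph_closed[OF assms(1,3) _ assms(4)])
  show "c b = c u" if "c a = c u" "{a, b} \<in> E" for a b
    using that assms(2)[of a b] by simp
qed simp

lemma simple_graph_finite_edges: "simple_graph V E \<Longrightarrow> finite V \<Longrightarrow> finite E"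
  by (rule finite_subset[of _ "Pow V"]) (auto simp: simple_graph_def)

lemma connected_graph_card_edges:
  fixes V :: "'v set"
  assumes "finite V" "simple_graph V E" "connected_graph V E"
  shows "card V \<le> card E + 1"
proof -
  obtain c :: "'v \<Rightarrow> 'v" where c: "\<forall>u v. {u, v} \<in> E \<longrightarrow> c u = c v" "card V \<le> card (c ` V) + card E"
    using component_labelling[OF assms(1) simple_graph_finite_edges[OF assms(2,1)] assms(2)]
        by blast
  obtain u where "u \<in> V"
    using assms(3) by (auto simp: connected_graph_def)
  then have "c ` V \<subseteq> {c u}"
    using connected_graph_label_const[OF assms(3), where c = c and u = u] c(1) by blast
  then have "card (c ` V) \<le> 1"
    using card_mono[of "{c u}" "c ` V"] by simp
  then show ?thesis
    using c(2) by simp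
qed

section \<open>Recognition of path graphs\<close>

lemma card_consecutive_pairs:
  assumes "distinct vs"
  shows "card {{vs ! i, vs ! Suc i} | i. Suc i < length vs} = length vs - 1"
proof -
  have "{{vs ! i, vs ! Suc i} | i. Suc i < length vs}
      = (\<lambda>i. {vs ! i, vs ! Suc i}) ` {..<length vs - 1}"
    by auto
  moreover have "inj_on (\<lambda>i. {vs ! i, vs ! Suc i}) {..<length vs - 1}"
    using assms by (auto simp: inj_on_def doubleton_eq_iff nth_eq_iff_index_eq)
  ultimately show ?thesis
    by (simp add: card_image)
qed

text \<open>A longest path visits every vertex. Otherwise some edge leaves it: at an end vertex the
  path could be extended, and at an inner vertex the degree would be at least three. The edges of a
  path through all vertices already number \<open>card V - 1\<close>, so there are no
  others.\<close>

lemma path_graphI: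
  assumes V: "finite V" and G: "simple_graph V E" "connected_graph V E" "card E + 1 \<le> card V"
    and deg: "\<And>v. v \<in> V \<Longrightarrow> card {e \<in> E. v \<in> e} \<le> 2"
  shows "path_graph V E"
proof -
  define path where "path vs \<longleftrightarrow> vs \<noteq> [] \<and> distinct vs \<and> set vs \<subseteq> V \<and>
    (\<forall>i. Suc i < length vs \<longrightarrow> {vs ! i, vs ! Suc i} \<in> E)" for vs
  have E: "finite E"
    using simple_graph_finite_edges[OF G(1) V] .
  have edge: "u \<in> V" "v \<in> V" "u \<noteq> v" if "{u, v} \<in> E" for u v
    using G(1) that by (auto simp: simple_graph_def card_2_iff doubleton_eq_iff)
  obtain v0 where "v0 \<in> V"
    using G(2) by (auto simp: connected_graph_def)
  then have "path [v0]"
    by (simp add: path_def)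
  moreover have "length vs < Suc (card V)" if "path vs" for vs
    using that V card_mono[of V "set vs"] by (auto simp: path_def distinct_card)
  ultimately obtain vs where vs: "path vs" and max: "\<And>ws. path ws \<Longrightarrow> length ws \<le> length vs"
    using ex_has_greatest_nat[of path "[v0]" length "Suc (card V)"] by (auto simp: less_imp_le)
  have "set vs = V"
  proof (rule ccontr)
    assume "set vs \<noteq> V"
    then obtain v where v: "v \<in> V" "v \<notin> set vs"
      using vs by (auto simp: path_def)
    have "hd vs \<in> V" "hd vs \<in> set vs"
      using vs by (auto simp: path_def)
    then obtain u w where uw: "u \<in> set vs" "w \<notin> set vs" "{u, w} \<in> E"
      using connected_graph_closed[OF G(2), of "hd vs" "\<lambda>w. w \<in> set vs" v] v by blast
    have w: "w \<in> V"
      using edge uw by blast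
    obtain i where i: "i < length vs" "u = vs ! i"
      using uw by (auto simp: in_set_conv_nth)
    show False
    proof (cases "i = 0 \<or> Suc i = length vs")
      case True
      have "path (w # vs)" if "i = 0"
        unfolding path_def
      proof (intro conjI allI impI)
        fix j assume "Suc j < length (w # vs)"
        then show "{(w # vs) ! j, (w # vs) ! Suc j} \<in> E"
          using vs uw i that by (cases j) (auto simp: path_def doubleton_eq_iff insert_commute[of w])
      qed (use vs uw w in \<open>auto simp: path_def\<close>)
      moreover have "path (vs @ [w])" if "Suc i = length vs"
        unfolding path_def
      proof (intro conjI allI impI)
        fix j assume "Suc j < length (vs @ [w])"
        then show "{(vs @ [w]) ! j, (vs @ [w]) ! Suc j} \<in> E"
          using vs uw i that by (cases "j = i") (auto simp: path_def nth_append)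
      qed (use vs uw w in \<open>auto simp: path_def\<close>)
      ultimately show False
        using True max[of "w # vs"] max[of "vs @ [w]"] by auto
    next
      case False
      then obtain j where j: "i = Suc j" "Suc i < length vs"
        using i by (cases i) auto
      let ?D = "{{vs ! j, u}, {u, vs ! Suc i}, {u, w}}"
      have "?D \<subseteq> {e \<in> E. u \<in> e}"
        using vs uw i j by (auto simp: path_def)
      then have "card ?D \<le> card {e \<in> E. u \<in> e}"
        using E by (intro card_mono) auto
      moreover have "vs ! j \<noteq> vs ! Suc i" "vs ! j \<noteq> w" "vs ! Suc i \<noteq> w" "vs ! j \<noteq> u" "vs ! Suc i \<noteq> u"
        using vs uw i j by (auto simp: path_def nth_eq_iff_index_eq)
      then have "card ?D = 3"
        by (auto simp: card_insert_if doubleton_eq_iff)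
      ultimately show False
        using deg[of u] uw edge by fastforce
    qed
  qed
  let ?D = "{{vs ! i, vs ! Suc i} | i. Suc i < length vs}"
  have "card ?D = length vs - 1" "length vs = card V"
    using vs \<open>set vs = V\<close> by (auto simp: path_def card_consecutive_pairs distinct_card)
  moreover have "?D \<subseteq> E"
    using vs by (auto simp: path_def)
  ultimately have "?D = E"
    using E G(3) card_mono[of E ?D] by (intro card_subset_eq) auto
  then show ?thesis
    unfolding path_graph_def using vs \<open>set vs = V\<close> by (intro exI[of _ vs]) (auto simp: path_def)
qed


section \<open>Generalized binomial edge ideals\<close>

text \<open>Indexing by a pair of row pair and column pair turns the generating set into the image
  of a product, which is easy to count.\<close>

definition minor :: "(nat \<times> nat) \<times> (nat \<times> nat) \<Rightarrow> (nat \<times> nat, 'k::field) mpolynomial" where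
  "minor = (\<lambda>((k, l), (i, j)). indeterminate (k, i) * indeterminate (l, j)
    - indeterminate (k, j) * indeterminate (l, i))"

definition row_pairs :: "nat \<Rightarrow> (nat \<times> nat) set" where
  "row_pairs m = {(k, l). 1 \<le> k \<and> k < l \<and> l \<le> m}"

definition edge_pairs :: "nat set set \<Rightarrow> (nat \<times> nat) set" where
  "edge_pairs E = {(i, j). {i, j} \<in> E \<and> i < j}"

lemma generalized_binomial_edge_ideal_eq:
  "(generalized_binomial_edge_ideal m n E :: (nat \<times> nat, 'k::field) mpolynomial set) =
    Idl\<^bsub>matrix_polynomial_ring m n\<^esub> (minor ` (row_pairs m \<times> edge_pairs E))"
proof -
  have "(minor ` (row_pairs m \<times> edge_pairs E) :: (nat \<times> nat, 'k) mpolynomial set)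
      = {minor ((k, l), (i, j)) | k l i j. 1 \<le> k \<and> k < l \<and> l \<le> m \<and> {i, j} \<in> E \<and> i < j}"
    unfolding row_pairs_def edge_pairs_def by blast
  then show ?thesis
    unfolding generalized_binomial_edge_ideal_def by (simp only: minor_def prod.case)
qed

lemma finite_row_pairs: "finite (row_pairs m)"
  by (rule finite_subset[of _ "{..m} \<times> {..m}"]) (auto simp: row_pairs_def)

lemma row_pairs_2: "row_pairs 2 = {(1, 2)}"
  by (auto simp: row_pairs_def)

text \<open>The \<open>m - 1\<close> pairs starting with 1, together with \<open>(2, 3)\<close>,
  suffice; the exact binomial coefficient is avoided.\<close>

lemma card_row_pairs_ge:
  assumes "m \<ge> 3"
  shows "m \<le> card (row_pairs m)"
proof -
  have "card (insert (2::nat, 3::nat) (Pair 1 ` {2..m})) \<le> card (row_pairs m)"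
    using assms finite_row_pairs by (intro card_mono) (auto simp: row_pairs_def)
  moreover have "card (insert (2::nat, 3::nat) (Pair 1 ` {2..m})) = m"
    using assms by (subst card_insert_disjoint) (auto simp: card_image inj_on_def)
  ultimately show ?thesis
    by simp
qed

lemma card_edge_pairs:
  assumes "simple_graph V E"
  shows "card (edge_pairs E) = card E"
proof -
  have "bij_betw (\<lambda>(i, j). {i, j}) (edge_pairs E) E"
  proof (rule bij_betw_imageI)
    show "inj_on (\<lambda>(i, j). {i, j}) (edge_pairs E)"
      by (auto simp: inj_on_def edge_pairs_def doubleton_eq_iff)
    have "e \<in> (\<lambda>(i, j). {i, j}) ` edge_pairs E" if e: "e \<in> E" for e
    proof -
      obtain i j where ij: "e = {i, j}" "i \<noteq> j"
        using assms e by (auto simp: simple_graph_def card_2_iff)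
      show ?thesis
      proof (cases "i < j")
        case True
        then show ?thesis
          using ij e by (intro image_eqI[of _ _ "(i, j)"]) (auto simp: edge_pairs_def)
      next
        case False
        then show ?thesis
          using ij e by (intro image_eqI[of _ _ "(j, i)"]) (auto simp: edge_pairs_def insert_commute)
      qed
    qed
    then show "(\<lambda>(i, j). {i, j}) ` edge_pairs E = E"
      by (auto simp: edge_pairs_def)
  qed
  then show ?thesis
    by (rule bij_betw_same_card)
qed

section \<open>Number of generators of the edge ideal\<close>

lemma edge_pairs_subset: "simple_graph V E \<Longrightarrow> edge_pairs E \<subseteq> V \<times> V"
  by (auto simp: simple_graph_def edge_pairs_def)

lemma minor_closed:
  assumes "simple_graph {1..n} E" "g \<in> row_pairs m \<times> edge_pairs E"
  shows "(minor g :: (nat \<times> nat, 'k::field) mpolynomial) \<in> carrier (matrix_polynomial_ring m n)"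
  using assms edge_pairs_subset[OF assms(1)] unfolding matrix_polynomial_ring_def minor_def
  by (auto simp: row_pairs_def intro!: polynomial_ring_closed)

text \<open>Here t and \<open>t'\<close> are the diagonal and antidiagonal monomials of a minor. All
  are products of two distinct variables, so none properly divides another. Increasing rows and
  columns make t injective and keep every \<open>t'\<close> different from every t.\<close>

lemma min_num_generators_edge_ideal_ge:
  fixes E :: "nat set set"
  assumes E: "simple_graph {1..n} E"
  shows "enat (card (row_pairs m) * card E) \<le>
    min_num_generators (matrix_polynomial_ring m n :: (nat \<times> nat, 'k::field) mpolynomial ring)
      (generalized_binomial_edge_ideal m n E)"
proof -
  let ?G = "row_pairs m \<times> edge_pairs E"
  let ?s = "\<lambda>a b :: nat \<times> nat. Poly_Mapping.single a (1::nat) + Poly_Mapping.single b 1"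
  define t :: "(nat \<times> nat) \<times> (nat \<times> nat) \<Rightarrow> nat \<times> nat \<Rightarrow>\<^sub>0 nat"
    where "t = (\<lambda>((k, l), (i, j)). ?s (k, i) (l, j))"
  define t' :: "(nat \<times> nat) \<times> (nat \<times> nat) \<Rightarrow> nat \<times> nat \<Rightarrow>\<^sub>0 nat"
    where "t' = (\<lambda>((k, l), (i, j)). ?s (k, j) (l, i))"
  have keys: "Poly_Mapping.keys (?s a b) = {a, b}" for a b
    by (auto simp: Poly_Mapping.in_keys_iff lookup_add lookup_single when_def split: if_splits)
  have s_eq: "{a, b} = {c, d}" if "?s a b = ?s c d" for a b c d
    using keys[of a b] keys[of c d] that by metis
  have s_minimal: "u = 0" if "?s a b + u = ?s c d" "a \<noteq> b" "c \<noteq> d" for a b c d u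
  proof -
    have "{a, b} \<subseteq> Poly_Mapping.keys (?s a b + u)"
      by (auto simp: Poly_Mapping.in_keys_iff lookup_add)
    then have "{a, b} \<subseteq> {c, d}"
      using that(1) keys by simp
    then have "?s a b = ?s c d"
      using that by (auto simp: add.commute)
    then show ?thesis
      using that(1) by (metis add_cancel_left_right)
  qed
  have minor: "minor g = Poly_Mapping.single (t g) 1
      - (Poly_Mapping.single (t' g) 1 :: (nat \<times> nat, 'k) mpolynomial)"
    for g
    by (simp add: minor_def t_def t'_def indeterminate_def mult_single split: prod.split)
  have "finite (edge_pairs E)"
    by (rule finite_subset[OF edge_pairs_subset[OF E]]) simp
  then have G: "finite ?G"
    using finite_row_pairs by simp
  have "enat (card ?G) \<le> min_num_generators (polynomial_ring ({1..m} \<times> {1..n}) :: (nat \<times> nat, 'k) mpolynomial ring)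
      (Idl\<^bsub>polynomial_ring ({1..m} \<times> {1..n})\<^esub> (minor ` ?G))"
  proof (rule min_num_generators_ge[OF G, where t = t])
    show "minor g \<in> carrier (polynomial_ring ({1..m} \<times> {1..n}))" if "g \<in> ?G" for g
      using minor_closed[OF E that] by (simp add: matrix_polynomial_ring_def)
  next
    fix g h and s u :: "nat \<times> nat \<Rightarrow>\<^sub>0 nat"
    assume gh: "g \<in> ?G" "h \<in> ?G" and s: "s \<in> Poly_Mapping.keys (minor g :: (nat \<times> nat, 'k) mpolynomial)" "s + u = t h"
    have "s = t g \<or> s = t' g"
      using s(1) by (auto simp: minor Poly_Mapping.in_keys_iff lookup_minus lookup_single when_def split: if_splits)
    then obtain a b where "s = ?s a b" "a \<noteq> b"
      using gh(1) by (auto simp: t_def t'_def row_pairs_def)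
    moreover obtain c d where "t h = ?s c d" "c \<noteq> d"
      using gh(2) by (auto simp: t_def row_pairs_def)
    ultimately show "u = 0"
      using s_minimal s(2) by metis
  next
    fix g h assume gh: "g \<in> ?G" "h \<in> ?G"
    obtain k l i j k' l' i' j' where eq: "g = ((k, l), (i, j))" "h = ((k', l'), (i', j'))"
      by (metis surj_pair)
    then have less: "k < l" "i < j" "k' < l'" "i' < j'"
      using gh by (auto simp: row_pairs_def edge_pairs_def)
    have "t g = t h \<longleftrightarrow> g = h"
    proof
      assume "t g = t h"
      then have "{(k, i), (l, j)} = {(k', i'), (l', j')}"
        unfolding t_def eq prod.case by (rule s_eq)
      then show "g = h"
        using less eq by (auto simp: doubleton_eq_iff)
    qed simp
    moreover have "t' g \<noteq> t h"
    proof
      assume "t' g = t h"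
      then have "{(k, j), (l, i)} = {(k', i'), (l', j')}"
        unfolding t_def t'_def eq prod.case by (rule s_eq)
      then show False
        using less by (auto simp: doubleton_eq_iff)
    qed
    ultimately show "Poly_Mapping.lookup (minor g :: (nat \<times> nat, 'k) mpolynomial) (t h) = (if g = h then 1 else 0)"
      by (auto simp: minor lookup_minus lookup_single when_def)
  qed
  then show ?thesis
    unfolding generalized_binomial_edge_ideal_eq matrix_polynomial_ring_def
    by (simp add: card_cartesian_product card_edge_pairs[OF E])
qed

text \<open>The primes containing the edge ideal come from deleting a set \<open>T\<close> of columns and making the
  remaining columns in one component proportional: \<open>c\<close> picks a representative column in each
  component, and the entry \<open>(1, i)\<close> of the target is the factor of column \<open>i\<close>.\<close>

definition column_parametrization ::
    "nat set \<Rightarrow> (nat \<Rightarrow> nat) \<Rightarrow> nat \<times> nat \<Rightarrow> (nat \<times> nat, 'k::field) mpolynomial" where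
  "column_parametrization T c = (\<lambda>(k, i). if i \<in> T then 0
     else indeterminate (k, c i) * (if c i = i then 1 else indeterminate (1, i)))"

text \<open>The kernel P of the parametrization is a prime over the edge ideal. Modulo P, the
  first-row entries of the surviving columns and the remaining entries of the representative columns
  are algebraically independent, which bounds the height of P.\<close>

lemma ideal_height_edge_ideal_le:
  fixes m n :: nat and E :: "nat set set" and T :: "nat set" and c :: "nat \<Rightarrow> nat"
  defines "U \<equiv> {1..n} - T"
  assumes m: "m \<ge> 1" and E: "simple_graph {1..n} E"
    and c: "\<And>i. i \<in> U \<Longrightarrow> c i \<in> U \<and> c (c i) = c i"
    and c_edge: "\<And>i j. {i, j} \<in> E \<Longrightarrow> i \<notin> T \<Longrightarrow> j \<notin> T \<Longrightarrow> c i = c j"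
  shows "ideal_height (matrix_polynomial_ring m n :: (nat \<times> nat, 'k::field) mpolynomial ring)
      (generalized_binomial_edge_ideal m n E)
    \<le> enat (m * n - ((m - 1) * card (c ` U) + card (U)))"
proof -
  let ?X = "{1..m} \<times> {1..n}"
  let ?R = "polynomial_ring ?X :: (nat \<times> nat, 'k) mpolynomial ring"
  let ?f = "column_parametrization T c :: nat \<times> nat \<Rightarrow> (nat \<times> nat, 'k) mpolynomial"
  interpret R: cring ?R by (rule cring_polynomial_ring)
  define P where "P = {p \<in> carrier ?R. insertion ?f p = 0}"
  have P: "primeideal P ?R"
    unfolding P_def by (rule primeideal_insertion_kernel)
  have "minor g \<in> P" if g: "g \<in> row_pairs m \<times> edge_pairs E" for g
  proof -
    obtain k l i j where eq: "g = ((k, l), (i, j))" and ij: "{i, j} \<in> E"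
      using g by (auto simp: edge_pairs_def)
    have "insertion ?f (minor g) = 0"
    proof (cases "i \<in> T \<or> j \<in> T")
      case True
      then show ?thesis
        by (auto simp: eq minor_def insertion_diff insertion_mult column_parametrization_def)
    next
      case False
      then have "c i = c j"
        using c_edge ij by auto
      then show ?thesis
        using False by (simp add: eq minor_def insertion_diff insertion_mult column_parametrization_def)
    qed
    then show ?thesis
      using minor_closed[OF E g] by (simp add: P_def matrix_polynomial_ring_def)
  qed
  then have sub: "generalized_binomial_edge_ideal m n E \<subseteq> P"
    unfolding generalized_binomial_edge_ideal_eq matrix_polynomial_ring_def
    using primeideal.axioms(1)[OF P] by (intro R.genideal_minimal) auto
  define W where "W = {2..m} \<times> c ` U \<union> {1} \<times> U"
  \<comment> \<open>The exponent vector of the image of a surviving entry.\<close>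
  define \<mu> :: "nat \<times> nat \<Rightarrow> nat \<times> nat \<Rightarrow>\<^sub>0 nat" where
    "\<mu> = (\<lambda>(k, i). Poly_Mapping.single (k, c i) 1 + (if c i = i then 0 else Poly_Mapping.single (1, i) 1))"
  have W: "finite W" "W \<subseteq> ?X"
    using m c by (auto simp: W_def U_def)
  have card_W: "card W = (m - 1) * card (c ` U) + card (U)"
    unfolding W_def by (subst card_Un_disjoint) (auto simp: card_cartesian_product U_def)
  have W_idem: "c (c (snd v)) = c (snd v)" and root_or_1: "c (snd v) = snd v \<or> fst v = 1"
    if "v \<in> W" for v
    using that c by (auto simp: W_def)
  have f_\<mu>: "?f w = Poly_Mapping.single (\<mu> w) 1" if "w \<in> W" for w
  proof -
    obtain k i where "w = (k, i)" "i \<in> U"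
      using \<open>w \<in> W\<close> c by (auto simp: W_def)
    then show ?thesis
      by (simp add: column_parametrization_def \<mu>_def indeterminate_def mult_single U_def)
  qed
  have indep: "a w = b w"
    if eq: "\<And>w. (\<Sum>v\<in>W. a v * Poly_Mapping.lookup (\<mu> v) w)
        = (\<Sum>v\<in>W. b v * Poly_Mapping.lookup (\<mu> v) w)"
      and w: "w \<in> W" for a b :: "nat \<times> nat \<Rightarrow> nat" and w
  proof -
    \<comment> \<open>The system is triangular. A nonroot entry \<open>(1, i)\<close> is the only
      one whose image contains the variable \<open>(1, i)\<close>, so its coefficient is read off
      first. After these have been removed, each root entry has its own variable.\<close>
    let ?roots = "{w \<in> W. c (snd w) = snd w}"
    have pick: "(\<Sum>v\<in>A. a v * Poly_Mapping.lookup (\<mu> v) w) = a w"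
      if "w \<in> A" "finite A" "\<And>v. v \<in> A \<Longrightarrow> Poly_Mapping.lookup (\<mu> v) w = (if v = w then 1 else 0)"
      for A w and a :: "nat \<times> nat \<Rightarrow> nat"
    proof -
      have "(\<Sum>v\<in>A. a v * Poly_Mapping.lookup (\<mu> v) w) = (\<Sum>v\<in>A. if v = w then a v else 0)"
        by (rule sum.cong) (simp_all add: that(3))
      also have "\<dots> = a w"
        using that(1,2) by simp
      finally show ?thesis .
    qed
    have nonroot: "a w = b w" if w: "w \<in> W" "w \<notin> ?roots" for w
    proof -
      obtain i where i: "w = (1, i)" "c i \<noteq> i"
        using w root_or_1[of w] by (cases w) auto
      have "Poly_Mapping.lookup (\<mu> v) w = (if v = w then 1 else 0)" if v: "v \<in> W" for v
      proof -
        obtain k' i' where v': "v = (k', i')"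
          by (cases v)
        have "c i' \<noteq> i" "i' = i \<Longrightarrow> k' = 1"
          using root_or_1[OF v] W_idem[OF v] i by (auto simp: v')
        then show ?thesis
          using i by (auto simp: v' \<mu>_def lookup_add lookup_single when_def)
      qed
      then show ?thesis
        using eq[of w] by (simp only: pick[OF w(1) W(1)])
    qed
    show ?thesis
    proof (cases "w \<in> ?roots")
      case True
      have roots: "Poly_Mapping.lookup (\<mu> v) w = (if v = w then 1 else 0)" if "v \<in> ?roots" for v
        using True that by (cases v; cases w) (auto simp: \<mu>_def lookup_single when_def)
      have split: "(\<Sum>v\<in>W. a v * Poly_Mapping.lookup (\<mu> v) w)
          = a w + (\<Sum>v\<in>W - ?roots. a v * Poly_Mapping.lookup (\<mu> v) w)" for a :: "nat \<times> nat \<Rightarrow> nat"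
      proof -
        have "(\<Sum>v\<in>W. a v * Poly_Mapping.lookup (\<mu> v) w)
          = (\<Sum>v\<in>?roots. a v * Poly_Mapping.lookup (\<mu> v) w)
            + (\<Sum>v\<in>W - ?roots. a v * Poly_Mapping.lookup (\<mu> v) w)"
          by (subst add.commute, rule sum.subset_diff) (use W(1) in auto)
        also have "(\<Sum>v\<in>?roots. a v * Poly_Mapping.lookup (\<mu> v) w) = a w"
          by (rule pick[OF True _ roots]) (use W(1) in simp_all)
        finally show ?thesis .
      qed
      have "(\<Sum>v\<in>W - ?roots. a v * Poly_Mapping.lookup (\<mu> v) w)
          = (\<Sum>v\<in>W - ?roots. b v * Poly_Mapping.lookup (\<mu> v) w)"
        using nonroot by (intro sum.cong) auto
      then show ?thesis
        using eq[of w] unfolding split by (simp only: add_right_cancel)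
    next
      case False
      then show ?thesis
        using nonroot w by blast
    qed
  qed
  \<comment> \<open>Enumerates W, since \<open>prime_height_le\<close> indexes the independent
    elements by an initial segment of the naturals.\<close>
  obtain e where e: "bij_betw e {..<card W} W"
    using ex_bij_betw_nat_finite[OF W(1)] by (auto simp: atLeast0LessThan)
  have eW: "e j \<in> W" if "j < card W" for j
    using e that by (auto simp: bij_betw_def)
  have "prime_height ?R P \<le> enat (card ?X - card W)"
  proof (rule prime_height_le[where z = "\<lambda>j. indeterminate (e j)"])
    show "indeterminate (e j) \<in> carrier ?R" if "j < card W" for j
      using W eW[OF that] by (intro polynomial_ring_closed) auto
    fix Q :: "(nat, 'k) mpolynomial"
    assume Q: "Q \<in> carrier (polynomial_ring {..<card W})" "insertion (\<lambda>j. indeterminate (e j)) Q \<in> P"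
    show "Q = 0"
    proof (rule insertion_monomials_eq_0[OF _ _ _ Q(1), where f = "\<lambda>j. ?f (e j)" and \<mu> = "\<lambda>j. \<mu> (e j)"])
      show "insertion (\<lambda>j. ?f (e j)) Q = 0"
        using Q(2) by (simp add: P_def insertion_insertion)
      fix a b :: "nat \<Rightarrow> nat"
      assume eq: "\<And>w. (\<Sum>u<card W. a u * Poly_Mapping.lookup (\<mu> (e u)) w)
          = (\<Sum>u<card W. b u * Poly_Mapping.lookup (\<mu> (e u)) w)"
      let ?e' = "the_inv_into {..<card W} e"
      have inv: "?e' (e u) = u" if "u < card W" for u
        using e that by (auto simp: bij_betw_def intro: the_inv_into_f_f)
      have "(\<Sum>v\<in>W. a (?e' v) * Poly_Mapping.lookup (\<mu> v) w)
          = (\<Sum>u<card W. a u * Poly_Mapping.lookup (\<mu> (e u)) w)" for a :: "nat \<Rightarrow> nat" and w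
        by (subst sum.reindex_bij_betw[OF e, symmetric]) (simp add: inv)
      then have "a (?e' w) = b (?e' w)" if "w \<in> W" for w
        using indep[of "\<lambda>v. a (?e' v)" "\<lambda>v. b (?e' v)", OF _ that] eq by simp
      then show "\<forall>u\<in>{..<card W}. a u = b u"
        using eW inv by (metis lessThan_iff)
    qed (use f_\<mu> eW in auto)
  qed simp
  moreover have "ideal_height ?R (generalized_binomial_edge_ideal m n E) \<le> prime_height ?R P"
    unfolding ideal_height_def using P sub by (intro Inf_lower) blast
  ultimately show ?thesis
    by (simp add: matrix_polynomial_ring_def card_W card_cartesian_product)
qed

theorem theorem2p3:
  fixes m n :: nat and E :: "nat set set"
  assumes "m \<ge> 2" and "n \<ge> 2"
    and "simple_graph {1..n} E" and "connected_graph {1..n} E"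
  shows "complete_intersection
           (matrix_polynomial_ring m n :: (nat \<times> nat, 'k::field) mpolynomial ring)
           (generalized_binomial_edge_ideal m n E)
         \<longleftrightarrow> m = 2 \<and> path_graph {1..n} E"
proof -
  let ?R = "matrix_polynomial_ring m n :: (nat \<times> nat, 'k) mpolynomial ring"
  let ?J = "generalized_binomial_edge_ideal m n E :: (nat \<times> nat, 'k) mpolynomial set"
  note E = assms(3)
  have finE: "finite E"
    using simple_graph_finite_edges[OF E] by simp
  have n_le: "n \<le> card E + 1"
    using connected_graph_card_edges[OF _ E assms(4)] by simp
  have mu_ge: "enat (card (row_pairs m) * card E) \<le> min_num_generators ?R ?J"
    by (rule min_num_generators_edge_ideal_ge[OF E])
  \<comment> \<open>No column is deleted, and all columns form one component with representative
    1.\<close>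
  have "ideal_height ?R ?J \<le> enat (m * n - ((m - 1) * card ((\<lambda>_. 1 :: nat) ` ({1..n} - {}))
      + card ({1..n} - {})))"
    using assms by (intro ideal_height_edge_ideal_le) auto
  moreover have "m * n - ((m - 1) * card ((\<lambda>_. 1 :: nat) ` ({1..n} - {})) + card ({1..n} - {}))
      = (m - 1) * (n - 1)"
    using assms(1,2) by (simp add: image_constant_conv algebra_simps)
  ultimately have ht_le: "ideal_height ?R ?J \<le> enat ((m - 1) * (n - 1))"
    by simp
  show ?thesis
  proof
    assume "complete_intersection ?R ?J"
    then have mu_ht: "min_num_generators ?R ?J = ideal_height ?R ?J"
      by (simp add: complete_intersection_def)
    \<comment> \<open>For a complete intersection, every upper bound on the height bounds the number
      of generators from above.\<close>
    have le_height: "card (row_pairs m) * card E \<le> b" if "ideal_height ?R ?J \<le> enat b" for b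
      using order_trans[OF mu_ge[unfolded mu_ht] that] by simp
    note le = le_height[OF ht_le]
    have m: "m = 2"
    proof (rule ccontr)
      assume "m \<noteq> 2"
      \<comment> \<open>For \<open>m \<ge> 3\<close> at least \<open>m * (n - 1)\<close> generators
        are needed, more than the height bound \<open>(m - 1) * (n - 1)\<close> allows.\<close>
      then have "m * (n - 1) \<le> card (row_pairs m) * card E"
        using assms(1) n_le by (intro mult_mono card_row_pairs_ge) auto
      also note le
      finally show False
        using assms(1,2) by simp
    qed
    then have card_E: "card E = n - 1"
      using le n_le by (simp add: row_pairs_2)
    have "card {e \<in> E. v \<in> e} \<le> 2" if v: "v \<in> {1..n}" for v
    proof (rule ccontr)
      assume deg: "\<not> ?thesis"
      \<comment> \<open>Deleting a vertex of degree at least three leaves \<open>n - 1\<close>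
        vertices and at most \<open>n - 4\<close> edges, hence at least three labels. The height
        bound drops to \<open>n - 2\<close>, below the \<open>n - 1\<close> generators
        needed.\<close>
      let ?V = "{1..n} - {v}" and ?E = "{e \<in> E. v \<notin> e}"
      have "simple_graph ?V ?E"
        using E by (auto simp: simple_graph_def)
      then obtain c :: "nat \<Rightarrow> nat" where c: "\<forall>v\<in>?V. c v \<in> ?V \<and> c (c v) = c v"
          "\<forall>u v. {u, v} \<in> ?E \<longrightarrow> c u = c v" "card ?V \<le> card (c ` ?V) + card ?E"
        using component_labelling[of ?V ?E] finE by auto
      have "card E = card {e \<in> E. v \<in> e} + card ?E"
        using finE by (subst card_Un_disjoint[symmetric]) (auto intro: arg_cong[of _ _ card])
      then have "3 \<le> card (c ` ?V)"
        using c(3) deg v card_E by simp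
      moreover have "ideal_height ?R ?J \<le> enat (m * n - ((m - 1) * card (c ` ?V) + card ?V))"
        using assms(1) c(1,2) by (intro ideal_height_edge_ideal_le[OF _ E]) auto
      then have "n - 1 \<le> 2 * n - (card (c ` ?V) + card ?V)"
        using le_height m card_E by (force simp: row_pairs_2)
      ultimately show False
        using v assms(2) by simp
    qed
    then have "path_graph {1..n} E"
      using E assms(2,4) card_E by (intro path_graphI) auto
    then show "m = 2 \<and> path_graph {1..n} E"
      using m by simp
  next
    assume "m = 2 \<and> path_graph {1..n} E"
    then obtain vs where m: "m = 2" and vs: "distinct vs" "set vs = {1..n}"
        and E_eq: "E = {{vs ! i, vs ! Suc i} | i. Suc i < length vs}"
      by (auto simp: path_graph_def)
    have len: "length vs = n"
      using vs distinct_card[of vs] by simp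
    have card_E: "card E = n - 1"
      using card_consecutive_pairs[OF vs(1)] by (simp only: E_eq len)
    let ?G = "row_pairs m \<times> edge_pairs E"
    interpret R: cring ?R
      unfolding matrix_polynomial_ring_def by (rule cring_polynomial_ring)
    have gens: "minor ` ?G \<subseteq> carrier ?R"
      using minor_closed[OF E] by blast
    have J: "?J = Idl\<^bsub>?R\<^esub> (minor ` ?G)"
      by (rule generalized_binomial_edge_ideal_eq)
    have finG: "finite ?G"
      using finite_row_pairs finite_subset[OF edge_pairs_subset[OF E]] by blast
    have card_G: "card ?G = n - 1"
      by (simp add: m row_pairs_2 card_cartesian_product card_edge_pairs[OF E] card_E)
    have "min_num_generators ?R ?J \<le> enat (card (minor ` ?G :: (nat \<times> nat, 'k) mpolynomial set))"
      unfolding min_num_generators_def using finG gens J by (intro Inf_lower) blast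
    also have "\<dots> \<le> enat (n - 1)"
      using card_image_le[OF finG, of minor] card_G by simp
    finally have mu: "min_num_generators ?R ?J = enat (n - 1)"
      using mu_ge card_E by (auto simp: m row_pairs_2 intro: antisym)
    have "enat (n - 1) \<le> ideal_height ?R ?J"
      unfolding ideal_height_def
    proof (rule Inf_greatest)
      fix h assume "h \<in> {prime_height ?R P | P. primeideal P ?R \<and> ?J \<subseteq> P}"
      then obtain P where h: "h = prime_height ?R P" and P: "primeideal P ?R" "?J \<subseteq> P"
        by blast
      interpret P: primeideal P ?R by (rule P)
      have minor_P: "minor ((1, 2), (i, j)) \<in> P" if "{i, j} \<in> E" "i < j" for i j
      proof -
        have "((1, 2), (i, j)) \<in> ?G"
          using that by (simp add: m row_pairs_2 edge_pairs_def)
        then show ?thesis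
          using R.genideal_self[OF gens] P(2) unfolding J by blast
      qed
      have uminus: "- p \<in> P" if "p \<in> P" for p
      proof -
        have "- 1 \<in> carrier ?R"
          unfolding matrix_polynomial_ring_def by (intro polynomial_ring_closed)
        then show ?thesis
          using P.I_l_closed[OF that, of "- 1"] by (simp add: matrix_polynomial_ring_def)
      qed
      \<comment> \<open>The two rows of the matrix, with the columns taken in the order of the
        path.\<close>
      let ?x = "\<lambda>k. (1 :: nat, vs ! k)" and ?y = "\<lambda>k. (2 :: nat, vs ! k)"
      have vs_mem: "vs ! k \<in> {1..n}" if "k < n" for k
        using that vs(2) len nth_mem by blast
      have inj: "inj_on (\<lambda>k. vs ! k) {..n - 1}"
        using vs(1) len assms(2) by (auto simp: inj_on_def nth_eq_iff_index_eq)
      have "enat (n - 1) \<le> prime_height (polynomial_ring ({1..m} \<times> {1..n})) P"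
      proof (rule prime_height_consecutive_minors[of ?x _ ?y])
        show "inj_on ?x {..n - 1}" "inj_on ?y {..n - 1}"
          using inj by (auto simp: inj_on_def)
        show "?x ` {..n - 1} \<inter> ?y ` {..n - 1} = {}"
          by auto
        show "?x ` {..n - 1} \<subseteq> {1..m} \<times> {1..n}"
          by (intro image_subsetI SigmaI vs_mem) (use assms(2) m in auto)
        show "?y ` {..n - 1} \<subseteq> {1..m} \<times> {1..n}"
          by (intro image_subsetI SigmaI vs_mem) (use assms(2) m in auto)
        show "primeideal P (polynomial_ring ({1..m} \<times> {1..n}))"
          using P(1) by (simp add: matrix_polynomial_ring_def)
        fix k assume k: "k < n - 1"
        let ?f = "\<lambda>k. indeterminate (?x k) * indeterminate (?y (Suc k))
          - indeterminate (?y k) * indeterminate (?x (Suc k)) :: (nat \<times> nat, 'k) mpolynomial"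
        have edge: "{vs ! k, vs ! Suc k} \<in> E"
          unfolding E_eq using k len by auto
        have ne: "vs ! k \<noteq> vs ! Suc k"
          using vs(1) k len by (simp add: nth_eq_iff_index_eq)
        show "?f k \<in> P"
        \<comment> \<open>The path may visit the two columns in decreasing order; then the generator
          with increasing columns differs from this minor by its sign.\<close>
        proof (cases "vs ! k < vs ! Suc k")
          case True
          have "?f k = minor ((1, 2), (vs ! k, vs ! Suc k))"
            by (simp add: minor_def mult.commute)
          then show ?thesis
            using minor_P[OF edge True] by simp
        next
          case False
          have "?f k = - minor ((1, 2), (vs ! Suc k, vs ! k))"
            by (simp add: minor_def mult.commute)
          moreover have "minor ((1, 2), (vs ! Suc k, vs ! k)) \<in> P"
            using edge False ne by (intro minor_P) (auto simp: insert_commute)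
          ultimately show ?thesis
            using uminus by simp
        qed
      qed
      then show "enat (n - 1) \<le> h"
        by (simp add: h matrix_polynomial_ring_def)
    qed
    then have "ideal_height ?R ?J = enat (n - 1)"
      using ht_le m by (auto intro: antisym)
    then show "complete_intersection ?R ?J"
      by (simp add: complete_intersection_def mu)
  qed
qed

end
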